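(* Let $T_2$ be a tree and $F$ a forest. The similarity matrix $S(F,T_2)$ can be computed in $\tilde O(|F|^2 |T_2|)$ time in the implicit matrix computation model described below.
   Context: Forests are ordered sequences of rooted ordered trees whose nodes carry labels from an alphabet $\Sigma$. Removing a node $v$ makes its children children of $v$'s parent, in $v$'s place and keeping their order. The tree edit distance $\mathsf{ed}(F_1,F_2)$ is the minimum number of unit-cost operations (relabeling a node, or removing a node, in either forest) needed to make $F_1$ and $F_2$ identical. The similarity is $\mathsf{sim}(F_1,F_2)=|F_1|+|F_2|-\mathsf{ed}(F_1,F_2)$, where $|F|$ is the number of nodes. Bi-order traversal sequence of a forest $G$: do a depth-first traversal from a virtual root whose children are the roots of $G$, visiting children left to right. Append a node each time the traversal enters and each time it leaves it (never the virtual root). The sequence has length $2|G|$, with entries $G(1),\dots,G(2|G|)$. For $1\le l\le r\le 2|G|+1$, $G[l,r)$ is $G$ with all nodes removed that appear at least once among $G(1..l-1)$ or $G(r..2|G|)$. Similarity matrix: $S(F,T_2)$ is the $(2|T_2|+1)\times(2|T_2|+1)$ matrix whose $(i,j)$ entry is $\mathsf{sim}(F,T_2[i,j))$ for $i\le j$ and $-\infty$ for $i>j$. Computation model: every matrix involved is row-monotone ($a_{i,j}\le a_{i,j+1}$) and column-monotone ($a_{i+1,j}\le a_{i,j}$), has entries in $\mathbb{N}\cup\{-\infty\}$, and is stored implicitly. Each of the following range operations and range queries costs $\tilde O(1)$ time. - Range operations: - create the all-$(-\infty)$ $n\times m$ matrix; - copy a matrix; - $\mathsf{rangemax}(A,i',j',x)$,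 which produces the matrix $B$ with $b_{ij}=\max(a_{ij},x)$ if $i\le i'$ and $j'\le j$, and $b_{ij}=a_{ij}$ otherwise. - Range queries: - the entry $A_{ij}$; - $\mathsf{mincol}(A,i,x)=\min\{j: A_{ij}\ge x\}$ (or an arbitrary column index if no such $j$ exists); - $\mathsf{maxrow}(A,j,x)=\max\{i: A_{ij}\ge x\}$ (or an arbitrary row index if no such $i$ exists). "Computing" a matrix means producing it in this model, so that these queries can then be answered; this is why the time bound may be smaller than the number of matrix entries. $\tilde O$ hides subpolynomial factors. *)

theory Defs
  imports
    "HOL-Library.Landau_Symbols"
    "HOL-Library.Option_ord"
    "Jordan_Normal_Form.Matrix"
begin

section \<open>Forests and tree edit distance\<close>

datatype 'a rtree = Node 'a "'a rtree list"

type_synonym 'a forest = "'a rtree list"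

fun fsize :: "'a forest \<Rightarrow> nat" where
  "fsize [] = 0"
| "fsize (Node a cs # ts) = Suc (fsize cs + fsize ts)"

definition labels :: "'a forest \<Rightarrow> 'a set" where
  "labels F = (\<Union>t\<in>set F. set_rtree t)"

inductive edit_step :: "'a forest \<Rightarrow> 'a forest \<Rightarrow> bool" where
  relabel: "edit_step (L @ Node a cs # R) (L @ Node b cs # R)"
| remove: "edit_step (L @ Node a cs # R) (L @ cs @ R)"
| below: "edit_step cs cs' \<Longrightarrow> edit_step (L @ Node a cs # R) (L @ Node a cs' # R)"

definition ed :: "'a forest \<Rightarrow> 'a forest \<Rightarrow> nat" where
  "ed F1 F2 =
     (LEAST n. \<exists>k1 k2 G. n = k1 + k2 \<and> (edit_step ^^ k1) F1 G \<and> (edit_step ^^ k2) F2 G)"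

lemma edit_steps_to_Nil: "(edit_step ^^ fsize F) F []"
proof (induction "fsize F" arbitrary: F)
  case 0
  then show ?case by (cases F rule: fsize.cases) auto
next
  case (Suc n)
  then obtain a cs ts where F: "F = Node a cs # ts"
    by (cases F rule: fsize.cases) auto
  have app: "fsize (xs @ ys) = fsize xs + fsize ys" for xs ys :: "'a forest"
    by (induction xs rule: fsize.induct) auto
  have "(edit_step ^^ n) (cs @ ts) []"
    using Suc F app[of cs ts] by (metis Suc_inject fsize.simps(2))
  moreover have "edit_step F (cs @ ts)"
    using edit_step.remove[of "[]" a cs ts] F by simp
  ultimately show ?case
    using Suc(2) by (metis relpowp_Suc_I2)
qed

lemma ed_le: "ed F1 F2 \<le> fsize F1 + fsize F2"
  unfolding ed_def by (rule Least_le) (use edit_steps_to_Nil in blast)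

text \<open>By \<open>ed_le\<close> the subtraction is never truncated.\<close>

definition sim :: "'a forest \<Rightarrow> 'a forest \<Rightarrow> nat" where
  "sim F1 F2 = fsize F1 + fsize F2 - ed F1 F2"


section \<open>Ranges of the bi-order traversal and the similarity matrix\<close>

text \<open>
  Distinct nodes may carry equal labels, so the nodes are first given distinct numbers (in preorder,
  starting from the first argument), and nodes are identified by their numbers.
\<close>

fun number :: "nat \<Rightarrow> 'a forest \<Rightarrow> (nat \<times> 'a) forest" where
  "number n [] = []"
| "number n (Node a cs # ts) =
     Node (n, a) (number (Suc n) cs) # number (Suc n + fsize cs) ts"

fun biorder :: "'a forest \<Rightarrow> 'a list" where
  "biorder [] = []"
| "biorder (Node a cs # ts) = a # biorder cs @ a # biorder ts"

fun remove_nodes :: "'a set \<Rightarrow> 'a forest \<Rightarrow> 'a forest" where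
  "remove_nodes X [] = []"
| "remove_nodes X (Node a cs # ts) =
     (if a \<in> X then remove_nodes X cs else [Node a (remove_nodes X cs)]) @ remove_nodes X ts"

text \<open>
  Positions count from 0, as in all lists and matrices below: for \<open>0 \<le> l \<le> r \<le> 2 * fsize G\<close>,
  \<open>subrange G l r\<close> is the forest written \<open>G[l+1, r+1)\<close> when positions count from 1.
\<close>

definition subrange :: "'a forest \<Rightarrow> nat \<Rightarrow> nat \<Rightarrow> 'a forest" where
  "subrange G l r =
     (let G' = number 0 G; seq = biorder G'
      in map (map_rtree snd) (remove_nodes (set (take l seq) \<union> set (drop r seq)) G'))"

text \<open>
  An entry \<open>None\<close> is \<open>-\<infinity>\<close>: in the order on type \<open>option\<close> used here it lies below every \<open>Some x\<close>.
\<close>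

type_synonym vmat = "nat option mat"

definition sim_matrix :: "'a forest \<Rightarrow> 'a rtree \<Rightarrow> vmat" where
  "sim_matrix F T =
     (let n = 2 * fsize [T] + 1
      in mat n n (\<lambda>(i, j). if i \<le> j then Some (sim F (subrange [T] i j)) else None))"


section \<open>Implicit matrices\<close>

definition neg_inf_mat :: "nat \<Rightarrow> nat \<Rightarrow> vmat" where
  "neg_inf_mat n m = mat n m (\<lambda>_. None)"

definition rangemax :: "vmat \<Rightarrow> nat \<Rightarrow> nat \<Rightarrow> nat \<Rightarrow> vmat" where
  "rangemax A i' j' x = mat (dim_row A) (dim_col A)
     (\<lambda>(i, j). if i \<le> i' \<and> j' \<le> j then max (A $$ (i, j)) (Some x) else A $$ (i, j))"

text \<open>The last argument \<open>d\<close> selects the arbitrary index that is returned if there is no proper answer.\<close>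

definition mincol :: "vmat \<Rightarrow> nat \<Rightarrow> nat \<Rightarrow> nat \<Rightarrow> nat" where
  "mincol A i x d =
     (if \<exists>j<dim_col A. Some x \<le> A $$ (i, j)
      then Min {j. j < dim_col A \<and> Some x \<le> A $$ (i, j)} else d mod dim_col A)"

definition maxrow :: "vmat \<Rightarrow> nat \<Rightarrow> nat \<Rightarrow> nat \<Rightarrow> nat" where
  "maxrow A j x d =
     (if \<exists>i<dim_row A. Some x \<le> A $$ (i, j)
      then Max {i. i < dim_row A \<and> Some x \<le> A $$ (i, j)} else d mod dim_row A)"

definition row_col_monotone :: "vmat \<Rightarrow> bool" where
  "row_col_monotone A \<longleftrightarrow>
     (\<forall>i j. i < dim_row A \<longrightarrow> Suc j < dim_col A \<longrightarrow> A $$ (i, j) \<le> A $$ (i, Suc j)) \<and>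
     (\<forall>i j. Suc i < dim_row A \<longrightarrow> j < dim_col A \<longrightarrow> A $$ (Suc i, j) \<le> A $$ (i, j))"

lemma row_col_monotone_neg_inf_mat: "row_col_monotone (neg_inf_mat n m)"
  by (auto simp: row_col_monotone_def neg_inf_mat_def)

lemma row_col_monotone_rangemax:
  "row_col_monotone A \<Longrightarrow> row_col_monotone (rangemax A i' j' x)"
  unfolding row_col_monotone_def rangemax_def
  by (auto simp: max.coboundedI1 intro: max.mono)


section \<open>A word RAM with implicit matrices\<close>

text \<open>
  Registers, arrays and matrix cells are addressed by numbers; a program can name only finitely many
  registers and arrays, while array positions and matrix cells are addressed by computed words.
  Words are the numbers below \<open>W\<close>, and addition is modulo \<open>W\<close>. Ordinary computation is charged one
  unit per operation. A range operation or range query is charged \<open>q\<close> units in addition to the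
  computation of its arguments.
\<close>

datatype aexp =
    Const nat
  | Reg nat
  | Read nat aexp      \<comment> \<open>array, position\<close>
  | Plus aexp aexp
  | Minus aexp aexp    \<comment> \<open>truncated at 0\<close>

datatype bexp = Eq aexp aexp | Less aexp aexp | Neg bexp | And bexp bexp

datatype com =
    Skip
  | Assign nat aexp
  | Write nat aexp aexp                 \<comment> \<open>array, position, value\<close>
  | Seq com com
  | Cond bexp com com
  | While bexp com
  | Create aexp aexp aexp               \<comment> \<open>target cell, number of rows, number of columns\<close>
  | Copy aexp aexp                      \<comment> \<open>target cell, source cell\<close>
  | Rangemax aexp aexp aexp aexp aexp   \<comment> \<open>target cell, source cell, row, column, value\<close>
  | Entry nat aexp aexp aexp            \<comment> \<open>target register, cell, row, column\<close>
  | Mincol nat aexp aexp aexp           \<comment> \<open>target register, cell, row, value\<close>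
  | Maxrow nat aexp aexp aexp           \<comment> \<open>target register, cell, column, value\<close>

record state =
  regs :: "nat \<Rightarrow> nat"
  arrs :: "nat \<Rightarrow> nat \<Rightarrow> nat"
  mats :: "nat \<Rightarrow> vmat"
  time :: nat

fun aval :: "nat \<Rightarrow> state \<Rightarrow> aexp \<Rightarrow> nat" where
  "aval W s (Const n) = n mod W"
| "aval W s (Reg r) = regs s r"
| "aval W s (Read a e) = arrs s a (aval W s e)"
| "aval W s (Plus e1 e2) = (aval W s e1 + aval W s e2) mod W"
| "aval W s (Minus e1 e2) = aval W s e1 - aval W s e2"

fun acost :: "aexp \<Rightarrow> nat" where
  "acost (Const n) = 1"
| "acost (Reg r) = 1"
| "acost (Read a e) = acost e + 1"
| "acost (Plus e1 e2) = acost e1 + acost e2 + 1"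
| "acost (Minus e1 e2) = acost e1 + acost e2 + 1"

fun bval :: "nat \<Rightarrow> state \<Rightarrow> bexp \<Rightarrow> bool" where
  "bval W s (Eq e1 e2) \<longleftrightarrow> aval W s e1 = aval W s e2"
| "bval W s (Less e1 e2) \<longleftrightarrow> aval W s e1 < aval W s e2"
| "bval W s (Neg b) \<longleftrightarrow> \<not> bval W s b"
| "bval W s (And b1 b2) \<longleftrightarrow> bval W s b1 \<and> bval W s b2"

fun bcost :: "bexp \<Rightarrow> nat" where
  "bcost (Eq e1 e2) = acost e1 + acost e2 + 1"
| "bcost (Less e1 e2) = acost e1 + acost e2 + 1"
| "bcost (Neg b) = bcost b + 1"
| "bcost (And b1 b2) = bcost b1 + bcost b2 + 1"

definition tick :: "nat \<Rightarrow> state \<Rightarrow> state" where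
  "tick k s = s\<lparr>time := time s + k\<rparr>"

definition set_reg :: "nat \<Rightarrow> nat \<Rightarrow> state \<Rightarrow> state" where
  "set_reg r v s = s\<lparr>regs := (regs s)(r := v)\<rparr>"

definition set_arr :: "nat \<Rightarrow> nat \<Rightarrow> nat \<Rightarrow> state \<Rightarrow> state" where
  "set_arr a p v s = s\<lparr>arrs := (arrs s)(a := (arrs s a)(p := v))\<rparr>"

definition set_mat :: "nat \<Rightarrow> vmat \<Rightarrow> state \<Rightarrow> state" where
  "set_mat h A s = s\<lparr>mats := (mats s)(h := A)\<rparr>"

text \<open>
  \<open>exec W q \<rho> c s s'\<close>: program \<open>c\<close>, started in \<open>s\<close>, halts in \<open>s'\<close>. Accessing a matrix outside its
  dimensions has no rule, so a program doing this does not halt. The sequence \<open>\<rho>\<close> supplies the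
  arbitrary answers of \<^const>\<open>mincol\<close> and \<^const>\<open>maxrow\<close>; it is indexed by the time, which grows
  with every query, so that the answers given in a run are independent of each other. An entry
  query must also be able to report \<open>-\<infinity>\<close>: it answers 0 for \<open>-\<infinity>\<close> and \<open>v + 1\<close> for the number \<open>v\<close>.
\<close>

inductive exec :: "nat \<Rightarrow> nat \<Rightarrow> (nat \<Rightarrow> nat) \<Rightarrow> com \<Rightarrow> state \<Rightarrow> state \<Rightarrow> bool"
  for W :: nat and q :: nat and \<rho> :: "nat \<Rightarrow> nat" where
  Skip: "exec W q \<rho> Skip s (tick 1 s)"
| Assign: "exec W q \<rho> (Assign r e) s (tick (acost e + 1) (set_reg r (aval W s e) s))"
| Write: "exec W q \<rho> (Write a e1 e2) s
     (tick (acost e1 + acost e2 + 1) (set_arr a (aval W s e1) (aval W s e2) s))"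
| Seq: "exec W q \<rho> c1 s1 s2 \<Longrightarrow> exec W q \<rho> c2 s2 s3 \<Longrightarrow> exec W q \<rho> (Seq c1 c2) s1 s3"
| CondTrue: "bval W s b \<Longrightarrow> exec W q \<rho> c1 (tick (bcost b + 1) s) s' \<Longrightarrow>
     exec W q \<rho> (Cond b c1 c2) s s'"
| CondFalse: "\<not> bval W s b \<Longrightarrow> exec W q \<rho> c2 (tick (bcost b + 1) s) s' \<Longrightarrow>
     exec W q \<rho> (Cond b c1 c2) s s'"
| WhileFalse: "\<not> bval W s b \<Longrightarrow> exec W q \<rho> (While b c) s (tick (bcost b + 1) s)"
| WhileTrue: "bval W s1 b \<Longrightarrow> exec W q \<rho> c (tick (bcost b + 1) s1) s2 \<Longrightarrow>
     exec W q \<rho> (While b c) s2 s3 \<Longrightarrow> exec W q \<rho> (While b c) s1 s3"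
| Create: "exec W q \<rho> (Create h e1 e2) s
     (tick (acost h + acost e1 + acost e2 + 1 + q)
       (set_mat (aval W s h) (neg_inf_mat (aval W s e1) (aval W s e2)) s))"
| Copy: "exec W q \<rho> (Copy h h') s
     (tick (acost h + acost h' + 1 + q) (set_mat (aval W s h) (mats s (aval W s h')) s))"
| Rangemax: "A = mats s (aval W s h') \<Longrightarrow> aval W s e1 < dim_row A \<Longrightarrow> aval W s e2 < dim_col A \<Longrightarrow>
     exec W q \<rho> (Rangemax h h' e1 e2 e3) s
     (tick (acost h + acost h' + acost e1 + acost e2 + acost e3 + 1 + q)
       (set_mat (aval W s h) (rangemax A (aval W s e1) (aval W s e2) (aval W s e3)) s))"
| Entry: "A = mats s (aval W s h) \<Longrightarrow> aval W s e1 < dim_row A \<Longrightarrow> aval W s e2 < dim_col A \<Longrightarrow>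
     exec W q \<rho> (Entry r h e1 e2) s
     (tick (acost h + acost e1 + acost e2 + 1 + q)
       (set_reg r ((case A $$ (aval W s e1, aval W s e2) of None \<Rightarrow> 0 | Some v \<Rightarrow> v + 1) mod W) s))"
| Mincol: "A = mats s (aval W s h) \<Longrightarrow> aval W s e1 < dim_row A \<Longrightarrow>
     exec W q \<rho> (Mincol r h e1 e2) s
     (tick (acost h + acost e1 + acost e2 + 1 + q)
       (set_reg r (mincol A (aval W s e1) (aval W s e2) (\<rho> (time s)) mod W) s))"
| Maxrow: "A = mats s (aval W s h) \<Longrightarrow> aval W s e1 < dim_col A \<Longrightarrow>
     exec W q \<rho> (Maxrow r h e1 e2) s
     (tick (acost h + acost e1 + acost e2 + 1 + q)
       (set_reg r (maxrow A (aval W s e1) (aval W s e2) (\<rho> (time s)) mod W) s))"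

inductive_cases exec_elims:
  "exec W q \<rho> Skip s s'" "exec W q \<rho> (Assign r e) s s'" "exec W q \<rho> (Write a e1 e2) s s'"
  "exec W q \<rho> (Seq c1 c2) s s'" "exec W q \<rho> (Cond b c1 c2) s s'"
  "exec W q \<rho> (Create h e1 e2) s s'" "exec W q \<rho> (Copy h h') s s'"
  "exec W q \<rho> (Rangemax h h' e1 e2 e3) s s'" "exec W q \<rho> (Entry r h e1 e2) s s'"
  "exec W q \<rho> (Mincol r h e1 e2) s s'" "exec W q \<rho> (Maxrow r h e1 e2) s s'"

inductive_cases exec_WhileE: "exec W q \<rho> (While b c) s s'"

text \<open>For given answers \<open>\<rho>\<close> there is at most one halting run.\<close>

lemma exec_deterministic: "exec W q \<rho> c s s1 \<Longrightarrow> exec W q \<rho> c s s2 \<Longrightarrow> s1 = s2"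
proof (induction arbitrary: s2 rule: exec.induct)
  case (WhileFalse s b c)
  then show ?case by (auto elim: exec_WhileE)
next
  case (WhileTrue s1 b c t s3)
  from WhileTrue.prems WhileTrue.hyps(1) obtain t'
    where "exec W q \<rho> c (tick (bcost b + 1) s1) t'" "exec W q \<rho> (While b c) t' s2"
    by (auto elim: exec_WhileE)
  with WhileTrue.IH show ?case by blast
next
  case (Seq c1 s1 s2 c2 s3)
  then show ?case by (blast elim: exec_elims)
next
  case (CondTrue s b c1 s' c2)
  from CondTrue.prems CondTrue.hyps(1) have "exec W q \<rho> c1 (tick (bcost b + 1) s) s2"
    by (auto elim: exec_elims)
  with CondTrue.IH show ?case by blast
next
  case (CondFalse s b c2 s' c1)
  from CondFalse.prems CondFalse.hyps(1) have "exec W q \<rho> c2 (tick (bcost b + 1) s) s2"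
    by (auto elim: exec_elims)
  with CondFalse.IH show ?case by blast
qed (erule exec_elims, simp)+

text \<open>
  A forest is given to the program as its traversal, one word per entry: the code of the label plus
  one when a node is entered, and 0 when it is left.
\<close>

fun encode :: "('a \<Rightarrow> nat) \<Rightarrow> 'a forest \<Rightarrow> nat list" where
  "encode code [] = []"
| "encode code (Node a cs # ts) = (code a + 1) # encode code cs @ 0 # encode code ts"

definition input_array :: "nat list \<Rightarrow> nat \<Rightarrow> nat" where
  "input_array xs p = (if p < length xs then xs ! p else 0)"

text \<open>
  Registers 0 and 1 hold the two sizes and arrays 0 and 1 the two traversals. All else is initially
  0, and all matrix cells hold the matrix without rows and columns.
\<close>

definition input_state :: "('a \<Rightarrow> nat) \<Rightarrow> 'a forest \<Rightarrow> 'a forest \<Rightarrow> state" where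
  "input_state code F G =
     \<lparr>regs = (\<lambda>_. 0)(0 := fsize F, 1 := fsize G),
      arrs = (\<lambda>_ _. 0)(0 := input_array (encode code F), 1 := input_array (encode code G)),
      mats = \<lambda>_. neg_inf_mat 0 0,
      time = 0\<rparr>"

text \<open>\<open>f n \<le> n powr o(1)\<close>\<close>

definition subpolynomial :: "(nat \<Rightarrow> nat) \<Rightarrow> bool" where
  "subpolynomial f \<longleftrightarrow> (\<forall>\<epsilon>>0. (\<lambda>n. real (f n)) \<in> O(\<lambda>n. real n powr \<epsilon>))"

end

theory Submission
  imports Defs "HOL-Library.Sublist"
begin

text \<open>
  In \<open>S(F, T\<^sub>2)\<close> every row takes at most \<open>2|F| + 1\<close> different numbers. A forest \<open>F\<^sub>1 F\<^sub>2\<close> is aligned with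
  a range \<open>[i, j)\<close> of the traversal by cutting the range at some \<open>k\<close>, so \<open>S(F\<^sub>1 F\<^sub>2, T\<^sub>2)\<close> is the
  max-plus product of \<open>S(F\<^sub>1, T\<^sub>2)\<close> and \<open>S(F\<^sub>2, T\<^sub>2)\<close>. By monotonicity the product is found by taking
  for each row \<open>i\<close> and each value \<open>x\<close> the first column \<open>k\<close> with entry at least \<open>x\<close>, and then for each
  value \<open>y\<close> the first column in row \<open>k\<close> of the second matrix with entry at least \<open>y\<close>; this takes
  \<open>O(|T\<^sub>2| (|F\<^sub>1| + 1) (|F\<^sub>2| + 1))\<close> operations. If \<open>F\<close> is a tree with root \<open>v\<close>, the matrix arises from that
  of the children by one range operation per node of \<open>T\<^sub>2\<close>, namely the match of \<open>v\<close> with this node.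
  Multiplying the trees of each sibling list from left to right costs \<open>O(|F|\<^sup>2 |T\<^sub>2|)\<close> in total, as
  every pair of nodes of \<open>F\<close> is charged for one product only.
\<close>

section \<open>Alignments and the edit distance\<close>

text \<open>Cutting a range \<open>[i, j)\<close> at \<open>k\<close> is not a split of the forest
  \<open>T\<^sub>2[i, j)\<close>: nodes that span \<open>k\<close> are missing on both sides. Within
  \<open>align\<close>, which compares two forests, the cut thus has no simple counterpart. This is
  why \<open>seq_align\<close> aligns a forest with an arbitrary list of entries, where an entry
  without a partner can only be skipped. A range is then a literal segment of the traversal and a
  cut is a list split. A node of \<open>T\<^sub>2\<close> with positions \<open>l < r\<close> is
  available exactly to the ranges with \<open>i \<le> l\<close> and \<open>r < j\<close>. This is a
  quadrant of the matrix, the shape that \<open>rangemax\<close> changes, and the weight to be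
  written there needs just the entry at \<open>(l + 1, r)\<close> of the matrix of the children. So
  one range operation per node suffices. The arbitrary answers of \<open>mincol\<close> never reach
  the result, because the program asks only for values below an entry that it has read in the last
  column of the same row, hence for values that are attained.\<close>

text \<open>
  A removed node contributes 0 to the weight, a matched pair 2 minus the cost of the relabeling. The
  inequality in the last rule makes the weights downward closed, so that \<open>align F G w\<close> is the
  threshold statement \<open>w \<le> sim F G\<close> and no maximum has to be formed.
\<close>

inductive align :: "'a forest \<Rightarrow> 'a forest \<Rightarrow> nat \<Rightarrow> bool" where
  Nil: "align [] [] 0"
| left: "align (cs @ ts) G w \<Longrightarrow> align (Node a cs # ts) G w"
| right: "align F (cs @ ts) w \<Longrightarrow> align F (Node b cs # ts) w"
| match: "align cs cs' w1 \<Longrightarrow> align ts ts' w2 \<Longrightarrow> w \<le> w1 + w2 + (if a = b then 2 else 1) \<Longrightarrow>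
    align (Node a cs # ts) (Node b cs' # ts') w"

lemma align_mono: "align F G w \<Longrightarrow> w' \<le> w \<Longrightarrow> align F G w'"
proof (induction arbitrary: w' rule: align.induct)
  case (match cs cs' w1 ts ts' w2 w a b)
  then show ?case using align.match[of cs cs' w1 ts ts' w2 w' a b] by simp
qed (simp_all add: align.Nil align.left align.right)

lemma align_sym: "align F G w \<Longrightarrow> align G F w"
proof (induction rule: align.induct)
  case (match cs cs' w1 ts ts' w2 w a b)
  then show ?case using align.match[of cs' cs w1 ts' ts w2 w b a] by (auto split: if_splits)
qed (simp_all add: align.Nil align.left align.right)

lemma fsize_append [simp]: "fsize (F @ G) = fsize F + fsize G"
  by (induction F rule: fsize.induct) auto

lemma align_refl: "align F F (2 * fsize F)"
proof (induction F rule: fsize.induct)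
  case (2 a cs ts)
  then show ?case by (intro align.match[OF 2]) auto
qed (simp add: align.Nil)

section \<open>Edit operations and the weight of alignments\<close>

lemma edit_step_Cons:
  assumes "edit_step F F'" shows "edit_step (t # F) (t # F')"
  using assms
proof (cases rule: edit_step.cases)
  case (relabel L a cs R b)
  then show ?thesis using edit_step.relabel[of "t # L" a cs R b] by simp
next
  case (remove L a cs R)
  then show ?thesis using edit_step.remove[of "t # L" a cs R] by simp
next
  case (below cs cs' L a R)
  then show ?thesis using edit_step.below[of cs cs' "t # L" a R] by simp
qed

lemma edit_step_append1:
  assumes "edit_step F F'" shows "edit_step (F @ G) (F' @ G)"
  using assms
proof (cases rule: edit_step.cases)
  case (relabel L a cs R b)
  then show ?thesis using edit_step.relabel[of L a cs "R @ G" b] by simp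
next
  case (remove L a cs R)
  then show ?thesis using edit_step.remove[of L a cs "R @ G"] by simp
next
  case (below cs cs' L a R)
  then show ?thesis using edit_step.below[of cs cs' L a "R @ G"] by simp
qed

lemma edit_step_append2: "edit_step F F' \<Longrightarrow> edit_step (L @ F) (L @ F')"
  by (induction L) (auto intro: edit_step_Cons)

text \<open>The rules of \<open>edit_step\<close> act at an arbitrary place of a sibling list.
  Splitting off only the first tree fits the rules of \<open>align\<close>, which consume their
  lists from the front.\<close>

lemma edit_step_caseE:
  assumes "edit_step F F'"
  obtains (relabel) a b cs R where "F = Node a cs # R" "F' = Node b cs # R"
  | (remove) a cs R where "F = Node a cs # R" "F' = cs @ R"
  | (below) a cs cs' R where "F = Node a cs # R" "F' = Node a cs' # R" "edit_step cs cs'"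
  | (tail) t R R' where "F = t # R" "F' = t # R'" "edit_step R R'"
  using assms
proof (cases rule: edit_step.cases)
  case (relabel L a cs R b)
  show ?thesis
  proof (cases L)
    case Nil then show ?thesis using relabel that(1) by simp
  next
    case (Cons t L')
    then show ?thesis using relabel that(4) edit_step.relabel[of L' a cs R b] by simp
  qed
next
  case (remove L a cs R)
  show ?thesis
  proof (cases L)
    case Nil then show ?thesis using remove that(2) by simp
  next
    case (Cons t L')
    then show ?thesis using remove that(4) edit_step.remove[of L' a cs R] by simp
  qed
next
  case (below cs cs' L a R)
  show ?thesis
  proof (cases L)
    case Nil then show ?thesis using below that(3) by simp
  next
    case (Cons t L')
    then show ?thesis using below that(4) edit_step.below[of cs cs' L' a R] by simp
  qed
qed

lemma edit_step_fsize: "edit_step F F' \<Longrightarrow> fsize F' \<le> fsize F \<and> fsize F \<le> fsize F' + 1"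
  by (induction rule: edit_step.induct) auto

text \<open>A weight stands for the total size minus a cost. Undoing an operation adds one to the
  cost and \<open>fsize F - fsize F'\<close> to the size, so the weight is kept for a removal and
  drops by one for a relabeling.\<close>

lemma align_edit_step:
  "align F' G x \<Longrightarrow> edit_step F F' \<Longrightarrow> align F G (x + fsize F - fsize F' - 1)"
proof (induction arbitrary: F rule: align.induct)
  case Nil
  then obtain a where "F = [Node a []]" by (auto elim: edit_step_caseE)
  then show ?case using align.left[of "[]" "[]" "[]" 0 a] align.Nil by simp
next
  case (left cs ts G w a)
  note L = align.left[OF left.hyps]
  show ?case using left.prems
  proof (cases rule: edit_step_caseE)
    case (relabel a' b cs' R)
    then show ?thesis using align_mono[OF L[of a'], of "w - 1"] by simp
  next
    case (remove a' cs' R)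
    then have "fsize F = Suc (fsize (Node a cs # ts))" by simp
    moreover have "align F G w" using L[of a] remove by (simp add: align.left)
    ultimately show ?thesis by simp
  next
    case (below a' cs1 cs2 R)
    then show ?thesis using left.IH[of "cs1 @ ts"] edit_step_append1[of cs1 cs2 ts]
      by (auto intro!: align.left)
  next
    case (tail t R R')
    then show ?thesis using left.IH[of "cs @ R"] edit_step_append2[of R R' cs]
      by (auto intro!: align.left)
  qed
next
  case (right F' cs ts w b)
  then show ?case by (auto intro: align.right)
next
  case (match cs cs' w1 ts ts' w2 w a b)
  show ?case using match.prems(1)
  proof (cases rule: edit_step_caseE)
    case (relabel a' b' cs'' R)
    then have "F = Node a' cs # ts" by simp
    moreover have "align (Node a' cs # ts) (Node b cs' # ts') (w - 1)"
      using match.hyps(3) by (intro align.match[OF match.hyps(1,2)]) (auto split: if_splits)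
    ultimately show ?thesis by simp
  next
    case (remove a' cs'' R)
    then have "fsize F = Suc (fsize (Node a cs # ts))" by simp
    moreover have "align F (Node b cs' # ts') w"
      using align.match[OF match.hyps] remove by (simp add: align.left)
    ultimately show ?thesis by simp
  next
    case (below a' cs1 cs2 R)
    then have "edit_step cs1 cs" by simp
    from edit_step_fsize[OF this] have
      "align (Node a cs1 # ts) (Node b cs' # ts') (w + fsize cs1 - fsize cs - 1)"
      using match.hyps(3)
      by (intro align.match[OF match.IH(1)[OF \<open>edit_step cs1 cs\<close>] match.hyps(2)]) linarith
    then show ?thesis using below by simp
  next
    case (tail t R R')
    then have "edit_step R ts" by simp
    from edit_step_fsize[OF this] have
      "align (Node a cs # R) (Node b cs' # ts') (w + fsize R - fsize ts - 1)"
      using match.hyps(3)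
      by (intro align.match[OF match.hyps(1) match.IH(2)[OF \<open>edit_step R ts\<close>]]) linarith
    then show ?thesis using tail by auto
  qed
qed

lemma align_edit_steps:
  "(edit_step ^^ k) F F' \<Longrightarrow> align F' G x \<Longrightarrow> align F G (x + fsize F - fsize F' - k)"
proof (induction k arbitrary: F)
  case (Suc k)
  then obtain F1 where F1: "edit_step F F1" "(edit_step ^^ k) F1 F'"
    by (meson relpowp_Suc_D2)
  show ?case
    using edit_step_fsize[OF F1(1)]
    by (intro align_mono[OF align_edit_step[OF Suc.IH[OF F1(2) Suc.prems(2)] F1(1)]]) linarith
qed simp

section \<open>From alignments to edit sequences\<close>

lemma edit_steps_map:
  assumes "\<And>F F'. edit_step F F' \<Longrightarrow> edit_step (f F) (f F')"
  shows "(edit_step ^^ k) F F' \<Longrightarrow> (edit_step ^^ k) (f F) (f F')"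
proof (induction k arbitrary: F')
  case (Suc k)
  then show ?case using assms by (auto simp: relcompp_apply)
qed simp

lemma edit_steps_trans:
  "(edit_step ^^ k) F G \<Longrightarrow> (edit_step ^^ l) G H \<Longrightarrow> (edit_step ^^ (k + l)) F H"
  by (auto simp: relpowp_add relcompp_apply)

lemma edit_step_remove_hd: "edit_step (Node a cs # ts) (cs @ ts)"
  using edit_step.remove[of "[]" a cs ts] by simp

text \<open>The common forest consists of the matched pairs with the labels of \<open>G\<close>:
  each unmatched node costs one removal, and every relabeling is done on the side of
  \<open>F\<close>.\<close>

lemma align_imp_edit_steps:
  "align F G w \<Longrightarrow> \<exists>k l H. (edit_step ^^ k) F H \<and> (edit_step ^^ l) G H \<and> k + l + w \<le> fsize F + fsize G"
proof (induction rule: align.induct)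
  case Nil
  show ?case by (intro exI[of _ 0] exI[of _ "[]"]) simp
next
  case (left cs ts G w a)
  then obtain k l H where H: "(edit_step ^^ k) (cs @ ts) H" "(edit_step ^^ l) G H"
    "k + l + w \<le> fsize (cs @ ts) + fsize G" by blast
  have "(edit_step ^^ Suc k) (Node a cs # ts) H"
    using edit_step_remove_hd H(1) by (rule relpowp_Suc_I2)
  then show ?case using H by (intro exI[of _ "Suc k"] exI[of _ l] exI[of _ H]) auto
next
  case (right F cs ts w a)
  then obtain k l H where H: "(edit_step ^^ k) F H" "(edit_step ^^ l) (cs @ ts) H"
    "k + l + w \<le> fsize F + fsize (cs @ ts)" by blast
  have "(edit_step ^^ Suc l) (Node a cs # ts) H"
    using edit_step_remove_hd H(2) by (rule relpowp_Suc_I2)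
  then show ?case using H by (intro exI[of _ k] exI[of _ "Suc l"] exI[of _ H]) auto
next
  case (match cs cs' w1 ts ts' w2 w a b)
  from match.IH obtain k1 l1 H1 k2 l2 H2 where
    1: "(edit_step ^^ k1) cs H1" "(edit_step ^^ l1) cs' H1" "k1 + l1 + w1 \<le> fsize cs + fsize cs'" and
    2: "(edit_step ^^ k2) ts H2" "(edit_step ^^ l2) ts' H2" "k2 + l2 + w2 \<le> fsize ts + fsize ts'"
    by blast
  have par: "(edit_step ^^ (k1 + k2)) (Node c us # vs) (Node c U # V)"
    if "(edit_step ^^ k1) us U" "(edit_step ^^ k2) vs V" for c us vs U V k1 k2
  proof (rule edit_steps_trans)
    show "(edit_step ^^ k1) (Node c us # vs) (Node c U # vs)"
      using edit_steps_map[OF _ that(1), of "\<lambda>F. Node c F # vs"] edit_step.below[of _ _ "[]" c vs]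
      by simp
    show "(edit_step ^^ k2) (Node c U # vs) (Node c U # V)"
      using edit_steps_map[OF _ that(2), of "\<lambda>F. Node c U # F"] edit_step_Cons by blast
  qed
  define e where "e = (if a = b then 0 else 1 :: nat)"
  have "(edit_step ^^ e) (Node a cs # ts) (Node b cs # ts)"
    using edit_step.relabel[of "[]" a cs ts b] by (auto simp: e_def)
  from edit_steps_trans[OF this par[OF 1(1) 2(1)]] par[OF 1(2) 2(2), of b] 1(3) 2(3) match.hyps(3)
  show ?case
    by (intro exI[of _ "e + (k1 + k2)"] exI[of _ "l1 + l2"] exI[of _ "Node b H1 # H2"])
      (auto simp: e_def)
qed

lemma le_sim_iff_align: "w \<le> sim F G \<longleftrightarrow> align F G w"
proof
  let ?P = "\<lambda>n. \<exists>k1 k2 H. n = k1 + k2 \<and> (edit_step ^^ k1) F H \<and> (edit_step ^^ k2) G H"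
  assume w: "w \<le> sim F G"
  have "?P (ed F G)"
    unfolding ed_def by (rule LeastI_ex) (use edit_steps_to_Nil in blast)
  then obtain k l H where H: "ed F G = k + l" "(edit_step ^^ k) F H" "(edit_step ^^ l) G H" by blast
  \<comment> \<open>\<open>H\<close> aligned with itself weighs \<open>2 * fsize H\<close>. Undoing
    the edits of \<open>F\<close> and then those of \<open>G\<close> leaves
    \<open>fsize F + fsize G - k - l\<close>.\<close>
  have "align F H (2 * fsize H + fsize F - fsize H - k)"
    using align_edit_steps[OF H(2) align_refl] .
  from align_edit_steps[OF H(3) align_sym[OF this]]
  have "align G F w" by (rule align_mono) (use w in \<open>simp add: sim_def H(1)\<close>)
  then show "align F G w" by (rule align_sym)
next
  assume "align F G w"
  then obtain k l H where H: "(edit_step ^^ k) F H" "(edit_step ^^ l) G H"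
    "k + l + w \<le> fsize F + fsize G" by (blast dest: align_imp_edit_steps)
  then have "ed F G \<le> k + l" unfolding ed_def by (intro Least_le) blast
  then show "w \<le> sim F G" using H by (simp add: sim_def)
qed

section \<open>Alignments with traversal sequences\<close>

text \<open>The first component of an entry only tells nodes with equal labels apart. Entries are
  skipped one by one, and no rule ties the two entries of a node together; this makes the relation
  meaningful for segments that contain only one of them.\<close>

inductive seq_align :: "'a forest \<Rightarrow> ('b \<times> 'a) list \<Rightarrow> nat \<Rightarrow> bool" where
  Nil: "seq_align [] u 0"
| left: "seq_align (cs @ ts) u w \<Longrightarrow> seq_align (Node a cs # ts) u w"
| skip: "seq_align F u w \<Longrightarrow> seq_align F (x # u) w"
| match: "seq_align cs u1 w1 \<Longrightarrow> seq_align ts u2 w2 \<Longrightarrow>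
    w \<le> w1 + w2 + (if a = snd b then 2 else 1) \<Longrightarrow> seq_align (Node a cs # ts) (b # u1 @ b # u2) w"

lemma seq_align_mono: "seq_align F u w \<Longrightarrow> w' \<le> w \<Longrightarrow> seq_align F u w'"
proof (induction arbitrary: w' rule: seq_align.induct)
  case (match cs u1 w1 ts u2 w2 w a b)
  then show ?case using seq_align.match[of cs u1 w1 ts u2 w2 w' a b] by simp
qed (simp_all add: seq_align.Nil seq_align.left seq_align.skip)

lemma seq_align_zero: "seq_align F u 0"
proof (induction "fsize F" arbitrary: F rule: less_induct)
  case less
  show ?case
  proof (cases F rule: fsize.cases)
    case (2 a cs ts)
    then show ?thesis using less[of "cs @ ts"] by (simp add: seq_align.left)
  qed (simp add: seq_align.Nil)
qed

lemma seq_align_skips: "seq_align F u w \<Longrightarrow> seq_align F (v @ u) w"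
  by (induction v) (auto intro: seq_align.skip)

lemma seq_align_subseq: "seq_align F u w \<Longrightarrow> subseq u v \<Longrightarrow> seq_align F v w"
proof (induction arbitrary: v rule: seq_align.induct)
  case (skip F u w x)
  then show ?case by (meson subseq_Cons')
next
  case (match cs u1 w1 ts u2 w2 w a b)
  from match.prems obtain p r where v: "v = p @ b # r" "subseq (u1 @ b # u2) r"
    by (auto dest: list_emb_ConsD)
  from list_emb_appendD[OF v(2)] obtain r1 r2 where
    r: "r = r1 @ r2" "subseq u1 r1" "subseq (b # u2) r2" by blast
  from r(3) obtain q s where s: "r2 = q @ b # s" "subseq u2 s"
    by (auto dest: list_emb_ConsD)
  have "seq_align (Node a cs # ts) (b # (r1 @ q) @ b # s) w"
    by (rule seq_align.match[OF match.IH(1) match.IH(2) match.hyps(3)])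
      (use r s in \<open>auto intro: list_emb_append2 subseq_order.trans[OF _ subseq_rev_drop_many]\<close>)
  then show ?case using seq_align_skips v(1) r(1) s(1) by force
qed (simp_all add: seq_align.Nil seq_align.left)

text \<open>A match consumes two occurrences of its entry, so entries that occur once are skipped in
  every alignment and can be deleted.\<close>

lemma seq_align_filter:
  "seq_align F u w \<Longrightarrow> (\<And>b. count_list u b \<ge> 2 \<Longrightarrow> P b) \<Longrightarrow> seq_align F (filter P u) w"
proof (induction rule: seq_align.induct)
  case (skip F u w x)
  then have "seq_align F (filter P u) w" by (auto split: if_splits)
  then show ?case by (simp add: seq_align.skip)
next
  case (match cs u1 w1 ts u2 w2 w a b)
  have "P b" by (rule match.prems) simp
  moreover have "seq_align cs (filter P u1) w1"
    by (rule match.IH(1), rule match.prems) (auto)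
  moreover have "seq_align ts (filter P u2) w2"
    by (rule match.IH(2), rule match.prems) (auto)
  ultimately show ?case using match.hyps(3) by (auto intro: seq_align.match)
qed (simp_all add: seq_align.Nil seq_align.left)

section \<open>Concatenations and single trees against a sequence\<close>

lemma seq_align_append_intro:
  "seq_align F u w1 \<Longrightarrow> seq_align G v w2 \<Longrightarrow> seq_align (F @ G) (u @ v) (w1 + w2)"
proof (induction rule: seq_align.induct)
  case (match cs u1 w1 ts u2 w2' w a b)
  from seq_align.match[OF match.hyps(1) match.IH(2)[OF match.prems], of "w + w2" a b] match.hyps(3)
  show ?case by simp
qed (simp_all add: seq_align.left seq_align.skip seq_align_skips)

text \<open>Siblings are matched in the order of the list, so all entries used by \<open>F\<close>
  precede those used by \<open>G\<close>, and the list can be cut between them.\<close>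

lemma seq_align_append_elim:
  "seq_align H u w \<Longrightarrow> H = F @ G \<Longrightarrow>
    \<exists>u1 u2 w1 w2. u = u1 @ u2 \<and> seq_align F u1 w1 \<and> seq_align G u2 w2 \<and> w \<le> w1 + w2"
proof (induction arbitrary: F rule: seq_align.induct)
  case (Nil u)
  then show ?case
    by (metis append_Nil append_is_Nil_conv add_0 order_refl seq_align.Nil)
next
  case (left cs ts u w a)
  show ?case
  proof (cases F)
    case Nil
    then show ?thesis using left.prems seq_align.left[OF left.hyps]
      by (metis append_Nil add_0 order_refl seq_align.Nil)
  next
    case (Cons t F')
    then have F: "F = Node a cs # F'" "cs @ ts = (cs @ F') @ G" using left.prems by auto
    from left.IH[OF F(2)] F(1) show ?thesis by (metis seq_align.left)
  qed
next
  case (skip H u w x)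
  from skip.IH[OF skip.prems] show ?case by (metis seq_align.skip append_Cons)
next
  case (match cs u1 w1 ts u2 w2 w a b)
  show ?case
  proof (cases F)
    case Nil
    then show ?thesis using match.prems seq_align.match[OF match.hyps]
      by (metis append_Nil add_0 order_refl seq_align.Nil)
  next
    case (Cons t F')
    then have F: "F = Node a cs # F'" "ts = F' @ G" using match.prems by auto
    from match.IH(2)[OF F(2)] obtain v1 v2 x1 x2 where
      v: "u2 = v1 @ v2" "seq_align F' v1 x1" "seq_align G v2 x2" "w2 \<le> x1 + x2" by blast
    have "seq_align F (b # u1 @ b # v1) (w1 + x1 + (if a = snd b then 2 else 1))"
      unfolding F(1) by (rule seq_align.match[OF match.hyps(1) v(2)]) simp
    then show ?thesis using v match.hyps(3)
      by (intro exI[of _ "b # u1 @ b # v1"] exI[of _ v2] exI conjI) (assumption | simp)+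
  qed
qed

lemma seq_align_append:
  "seq_align (F @ G) u w \<longleftrightarrow>
    (\<exists>u1 u2 w1 w2. u = u1 @ u2 \<and> seq_align F u1 w1 \<and> seq_align G u2 w2 \<and> w \<le> w1 + w2)"
  using seq_align_append_elim[of "F @ G" u w F G] seq_align_append_intro seq_align_mono by blast

lemma seq_align_Nil: "seq_align [] u w \<longleftrightarrow> w = 0"
proof
  show "seq_align [] u w \<Longrightarrow> w = 0"
    by (induction "[] :: 'a forest" u w rule: seq_align.induct) auto
qed (simp add: seq_align.Nil)

lemma seq_align_root_elim:
  "seq_align F u w \<Longrightarrow> F = [Node a cs] \<Longrightarrow> seq_align cs u w \<or>
    (\<exists>u0 b u1 u2 w1. u = u0 @ b # u1 @ b # u2 \<and> seq_align cs u1 w1 \<and>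
      w \<le> w1 + (if a = snd b then 2 else 1))"
proof (induction rule: seq_align.induct)
  case (skip F u w x)
  from skip.IH[OF skip.prems] show ?case
  proof
    assume "seq_align cs u w"
    then show ?thesis by (simp add: seq_align.skip)
  next
    assume "\<exists>u0 b u1 u2 w1. u = u0 @ b # u1 @ b # u2 \<and> seq_align cs u1 w1 \<and>
      w \<le> w1 + (if a = snd b then 2 else 1)"
    then show ?thesis by (metis append_Cons)
  qed
next
  case (match cs' u1 w1 ts u2 w2 w a' b)
  then have "w \<le> w1 + (if a = snd b then 2 else 1)" "seq_align cs u1 w1"
    by (auto simp: seq_align_Nil)
  then show ?case by (metis append_Nil)
qed simp_all

text \<open>The root has no siblings: once it is matched, everything outside the two entries of its
  partner is skipped, and only the children remain to be aligned with what lies between.\<close>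

lemma seq_align_root:
  "seq_align [Node a cs] u w \<longleftrightarrow> seq_align cs u w \<or>
    (\<exists>u0 b u1 u2 w1. u = u0 @ b # u1 @ b # u2 \<and> seq_align cs u1 w1 \<and>
      w \<le> w1 + (if a = snd b then 2 else 1))" (is "_ \<longleftrightarrow> _ \<or> ?R")
proof -
  have "seq_align [Node a cs] u w" if ?R
  proof -
    from that obtain u0 b u1 u2 w1 where *: "u = u0 @ b # u1 @ b # u2" "seq_align cs u1 w1"
      "w \<le> w1 + (if a = snd b then 2 else 1)" by blast
    then have "seq_align [Node a cs] (b # u1 @ b # u2) w"
      by (intro seq_align.match[OF _ seq_align.Nil]) auto
    then show ?thesis using *(1) by (simp add: seq_align_skips)
  qed
  then show ?thesis
    using seq_align_root_elim[OF _ refl, of a cs u w] seq_align.left[of cs "[]" u w a]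
    unfolding append_Nil2 by blast
qed

section \<open>Sequences that are traversals of forests\<close>

lemma biorder_append: "biorder (F @ G) = biorder F @ biorder G"
  by (induction F rule: biorder.induct) auto

lemma length_biorder: "length (biorder F) = 2 * fsize F"
  by (induction F rule: biorder.induct) auto

text \<open>Removing a node of \<open>G\<close> becomes skipping its two entries. The forest
  \<open>H\<close> is \<open>G\<close> with its nodes tagged, so that entries can be told
  apart.\<close>

lemma align_imp_seq_align:
  "align F G w \<Longrightarrow> G = map (map_rtree snd) H \<Longrightarrow> seq_align F (biorder H) w"
proof (induction arbitrary: H rule: align.induct)
  case (right F cs ts w b)
  from right.prems obtain b' cs' H' where H: "H = Node b' cs' # H'" "cs = map (map_rtree snd) cs'"
    "ts = map (map_rtree snd) H'"
    by (cases H rule: fsize.cases) auto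
  from right.IH[of "cs' @ H'"] H have "seq_align F (biorder cs' @ biorder H') w"
    by (simp add: biorder_append)
  then show ?case
    by (rule seq_align_subseq)
      (unfold H biorder.simps, intro list_emb_Cons list_emb_append_mono subseq_order.order_refl)
next
  case (match cs cs' w1 ts ts' w2 w a b)
  from match.prems obtain b' cs'' H' where H: "H = Node b' cs'' # H'" "cs' = map (map_rtree snd) cs''"
    "ts' = map (map_rtree snd) H'" "b = snd b'"
    by (cases H rule: fsize.cases) auto
  from seq_align.match[OF match.IH(1)[OF H(2)] match.IH(2)[OF H(3)], of w a b'] match.hyps(3) H
  show ?case by simp
qed (simp_all add: seq_align.Nil seq_align.left)

lemma length_encode: "length (encode code F) = 2 * fsize F"
  by (induction F rule: fsize.induct) auto

text \<open>As no entry occurs more than twice, two matched positions belong to the same node.\<close>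

lemma seq_align_imp_align:
  "seq_align F (biorder H) w \<Longrightarrow> (\<And>b. count_list (biorder H) b \<le> 2) \<Longrightarrow>
    align F (map (map_rtree snd) H) w"
proof (induction "fsize F + fsize H" arbitrary: F H w rule: less_induct)
  case less
  show ?case using less.prems(1)
  proof (cases rule: seq_align.cases)
    case Nil
    have "align [] G 0" for G :: "'a forest"
    proof (induction "fsize G" arbitrary: G rule: less_induct)
      case less
      then show ?case by (cases G rule: fsize.cases) (auto intro: align.Nil align.right)
    qed
    then show ?thesis using Nil by simp
  next
    case (left cs ts a)
    then show ?thesis using less.hyps[of "cs @ ts" H w] less.prems(2)
      by (auto intro: align.left)
  next
    case (skip u x)
    then obtain b cs ts where H: "H = Node b cs # ts"
      by (cases H rule: fsize.cases) auto
    have b: "b \<notin> set (biorder cs)" "b \<notin> set (biorder ts)"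
      using less.prems(2)[of b] by (auto simp: H count_list_0_iff[symmetric])
    \<comment> \<open>With the entering entry of \<open>b\<close> skipped, the leaving one has no
      partner left. Dropping both turns the skip into the removal of the node.\<close>
    have "seq_align F (filter (\<lambda>y. y \<noteq> b) u) w"
      using skip H b by (intro seq_align_filter) (auto split: if_splits)
    also have "filter (\<lambda>y. y \<noteq> b) u = biorder (cs @ ts)"
    proof -
      have "filter (\<lambda>y. y \<noteq> b) (biorder G) = biorder G" if "b \<notin> set (biorder G)" for G
        using that by (auto simp: filter_id_conv)
      moreover have "u = biorder cs @ b # biorder ts" using skip H by auto
      ultimately show ?thesis using b by (simp add: biorder_append)
    qed
    finally have "align F (map (map_rtree snd) (cs @ ts)) w"
    proof (intro less.hyps)
      fix c show "count_list (biorder (cs @ ts)) c \<le> 2"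
        using less.prems(2)[of c] by (auto simp: H biorder_append split: if_splits)
    qed (simp_all add: H)
    then show ?thesis by (cases b) (auto simp: H intro: align.right)
  next
    case (match cs u1 w1 ts u2 w2 a b)
    then obtain cs' ts' where H: "H = Node b cs' # ts'"
      by (cases H rule: fsize.cases) auto
    have b: "b \<notin> set (biorder cs')" "b \<notin> set (biorder ts')"
      using less.prems(2)[of b] by (auto simp: H count_list_0_iff[symmetric])
    have eq: "biorder cs' @ b # biorder ts' = u1 @ b # u2" using match H by simp
    \<comment> \<open>The only remaining \<open>b\<close> is the leaving entry of the first root, so
      the match cuts the list exactly into the traversals of \<open>cs'\<close> and
      \<open>ts'\<close>.\<close>
    have "count_list (u1 @ b # u2) b = 1"
      unfolding eq[symmetric] using b by (simp add: count_list_0_iff)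
    then have "b \<notin> set u1" by (simp add: count_list_0_iff[symmetric])
    with b eq have u: "u1 = biorder cs'" "u2 = biorder ts'"
      by (auto simp: append_Cons_eq_iff)
    have c: "count_list (biorder cs') c \<le> 2" "count_list (biorder ts') c \<le> 2" for c
      using less.prems(2)[of c] by (auto simp: H split: if_splits)
    have "align cs (map (map_rtree snd) cs') w1" "align ts (map (map_rtree snd) ts') w2"
      using match u c by (auto intro!: less.hyps simp: H)
    from align.match[OF this, of w a "snd b"] match show ?thesis
      by (cases b) (simp add: H)
  qed
qed

section \<open>Ranges of the traversal\<close>

lemma biorder_remove_nodes: "biorder (remove_nodes X F) = filter (\<lambda>a. a \<notin> X) (biorder F)"
  by (induction X F rule: remove_nodes.induct) (auto simp: biorder_append)

lemma fst_biorder_number: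
  "b \<in> set (biorder (number n F)) \<Longrightarrow> n \<le> fst b \<and> fst b < n + fsize F"
proof (induction n F rule: number.induct)
  case (2 n a cs ts)
  from 2(3) consider "b = (n, a)" | "b \<in> set (biorder (number (Suc n) cs))"
    | "b \<in> set (biorder (number (Suc n + fsize cs) ts))" by auto
  then show ?case using 2(1,2) by cases auto
qed simp

lemma count_list_biorder_number: "count_list (biorder (number n F)) b \<le> 2"
proof (induction n F rule: number.induct)
  case (2 n a cs ts)
  have "count_list (biorder (number m G)) c = 0" if "fst c < m \<or> m + fsize G \<le> fst c"
    for m and G :: "'a forest" and c
    using fst_biorder_number[of c m G] that by (fastforce simp: count_list_0_iff)
  from this[where c = b] 2 show ?case by (cases "fst b < Suc n + fsize cs") auto
qed simp

lemma fsize_number [simp]: "fsize (number n F) = fsize F"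
  by (induction n F rule: number.induct) auto

lemma map_snd_number: "map (map_rtree snd) (number n F) = F"
  by (induction n F rule: number.induct) auto

definition traversal_seg :: "'a forest \<Rightarrow> nat \<Rightarrow> nat \<Rightarrow> (nat \<times> 'a) list" where
  "traversal_seg G i j = drop i (take j (biorder (number 0 G)))"

text \<open>The traversal of the range forest arises from the segment by deleting the entries whose
  node also occurs outside. Such an entry occurs at most once in the segment, so it could not be
  matched anyway.\<close>

lemma le_sim_subrange_iff:
  assumes "i \<le> j"
  shows "w \<le> sim F (subrange G i j) \<longleftrightarrow> seq_align F (traversal_seg G i j) w"
proof -
  define s where "s = biorder (number 0 G)"
  define X where "X = set (take i s) \<union> set (drop j s)"
  define H where "H = remove_nodes X (number 0 G)"
  define m where "m = traversal_seg G i j"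
  have s: "s = take i s @ m @ drop j s"
  proof -
    have "take j s = take i (take j s) @ drop i (take j s)"
      by (rule append_take_drop_id[symmetric])
    also have "take i (take j s) = take i s" using assms by (simp add: min_def)
    finally show ?thesis
      unfolding m_def traversal_seg_def s_def[symmetric]
      by (metis append.assoc append_take_drop_id)
  qed
  have c2: "count_list s b \<le> 2" for b
    by (simp add: s_def count_list_biorder_number)
  have bH: "biorder H = filter (\<lambda>a. a \<notin> X) m"
    unfolding H_def biorder_remove_nodes s_def[symmetric]
    by (subst s) (auto simp: X_def filter_empty_conv)
  have c: "b \<notin> X" if "count_list m b \<ge> 2" for b
  proof -
    have "count_list s b = count_list (take i s) b + count_list m b + count_list (drop j s) b"
      by (subst s) simp
    then show ?thesis using that c2[of b] by (auto simp: X_def count_list_0_iff[symmetric])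
  qed
  have cH: "count_list (biorder H) b \<le> 2" for b
  proof -
    have "count_list (filter P xs) b \<le> count_list xs b" for P xs by (induction xs) auto
    then show ?thesis using c2[of b] unfolding H_def biorder_remove_nodes s_def[symmetric]
      using order.trans by blast
  qed
  have sub: "subrange G i j = map (map_rtree snd) H"
    by (simp add: subrange_def H_def X_def s_def Let_def)
  have "w \<le> sim F (subrange G i j) \<longleftrightarrow> seq_align F (biorder H) w"
    unfolding le_sim_iff_align sub
    using align_imp_seq_align[OF _ refl] seq_align_imp_align[OF _ cH] by blast
  also have "\<dots> \<longleftrightarrow> seq_align F m w"
    unfolding bH
    using seq_align_filter[of F m w "\<lambda>a. a \<notin> X"] c seq_align_subseq[OF _ subseq_filter_left]
    by blast
  finally show ?thesis by (simp add: m_def)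
qed

section \<open>Nodes as pairs of positions in the traversal\<close>

fun occs :: "nat \<Rightarrow> 'a forest \<Rightarrow> (nat \<times> nat \<times> 'a) set" where
  "occs p [] = {}"
| "occs p (Node a cs # ts) =
     occs (Suc p) cs \<union> {(p, p + 1 + 2 * fsize cs, a)} \<union> occs (p + 2 + 2 * fsize cs) ts"

lemma occs_map: "occs p (map (map_rtree f) F) = (\<lambda>(l, r, b). (l, r, f b)) ` occs p F"
proof -
  have "fsize (map (map_rtree f) F) = fsize F" for F
    by (induction F rule: fsize.induct) auto
  then show ?thesis by (induction p F rule: occs.induct) (auto simp: image_Un)
qed

lemma occs_bounds: "(l, r, b) \<in> occs p F \<Longrightarrow> p \<le> l \<and> l < r \<and> r < p + 2 * fsize F"
  by (induction p F rule: occs.induct) fastforce+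

lemma occs_nth:
  "(l, r, b) \<in> occs p F \<Longrightarrow> biorder F ! (l - p) = b \<and> biorder F ! (r - p) = b"
proof (induction p F rule: occs.induct)
  case (2 p a cs ts)
  from 2(3) consider "(l, r, b) \<in> occs (Suc p) cs" | "l = p" "r = p + 1 + 2 * fsize cs" "b = a"
    | "(l, r, b) \<in> occs (p + 2 + 2 * fsize cs) ts" by auto
  then show ?case
  proof cases
    case 1
    from 2(1)[OF 1] occs_bounds[OF 1] show ?thesis
      by (auto simp: nth_append nth_Cons' length_biorder diff_diff_add)
  next
    case 2
    then show ?thesis by (simp add: nth_append length_biorder)
  next
    case 3
    have "biorder (Node a cs # ts) ! (k - p) = biorder ts ! (k - (p + 2 + 2 * fsize cs))"
      if "p + 2 + 2 * fsize cs \<le> k" for k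
    proof -
      from that obtain d where "k = p + 2 + 2 * fsize cs + d" using le_Suc_ex by blast
      then show ?thesis by (simp add: nth_append length_biorder)
    qed
    with 2(2)[OF 3] occs_bounds[OF 3] show ?thesis by auto
  qed
qed simp

lemma occs_ex: "b \<in> set (biorder F) \<Longrightarrow> \<exists>l r. (l, r, b) \<in> occs p F"
proof (induction p F rule: occs.induct)
  case (2 p a cs ts)
  note IH = 2(1,2)
  from 2(3) consider "b = a" | "b \<in> set (biorder cs)" | "b \<in> set (biorder ts)" by auto
  then show ?case
  proof cases
    case 2
    with IH(1) show ?thesis by (simp, blast)
  next
    case 3
    with IH(2) show ?thesis by (simp, blast)
  qed auto
qed simp

text \<open>At most two positions carry \<open>b\<close>, and \<open>occs\<close> already provides
  two of them; by counting, any other pair of such positions is the same pair.\<close>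

lemma occs_iff:
  assumes "\<And>b. count_list (biorder F) b \<le> 2"
  shows "(l, r, b) \<in> occs 0 F \<longleftrightarrow>
    l < r \<and> r < 2 * fsize F \<and> biorder F ! l = b \<and> biorder F ! r = b"
proof
  assume "(l, r, b) \<in> occs 0 F"
  from occs_bounds[OF this] occs_nth[OF this]
  show "l < r \<and> r < 2 * fsize F \<and> biorder F ! l = b \<and> biorder F ! r = b" by simp
next
  assume *: "l < r \<and> r < 2 * fsize F \<and> biorder F ! l = b \<and> biorder F ! r = b"
  then have "b \<in> set (biorder F)" by (metis length_biorder nth_mem)
  then obtain l' r' where o: "(l', r', b) \<in> occs 0 F" by (blast dest: occs_ex)
  define I where "I = {i. i < length (biorder F) \<and> b = biorder F ! i}"
  have "card I = count_list (biorder F) b"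
    by (simp add: I_def count_list_eq_length_filter length_filter_conv_card)
  then have "card I \<le> 2" using assms by simp
  moreover have "finite I" "l \<in> I" "r \<in> I" "l' \<in> I" "r' \<in> I"
    using * occs_bounds[OF o] occs_nth[OF o] by (auto simp: I_def length_biorder)
  moreover have "l' < r'" "l < r" using occs_bounds[OF o] * by auto
  ultimately have "{l, r} = I" "{l', r'} = I"
    using card_seteq[of I "{l, r}"] card_seteq[of I "{l', r'}"] by simp_all
  then have "{l, r} = {l', r'}" by simp
  then have "l = l'" "r = r'" using \<open>l' < r'\<close> \<open>l < r\<close> by (auto simp: doubleton_eq_iff)
  then show "(l, r, b) \<in> occs 0 F" using o by simp
qed

section \<open>Cutting segments of the traversal\<close>

lemma traversal_seg_split:
  assumes "i \<le> j"
  shows "traversal_seg G i j = u @ v \<longleftrightarrow>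
    (\<exists>k. i \<le> k \<and> k \<le> j \<and> u = traversal_seg G i k \<and> v = traversal_seg G k j)"
proof
  assume uv: "traversal_seg G i j = u @ v"
  define s where "s = biorder (number 0 G)"
  have uv: "drop i (take j s) = u @ v" using uv by (simp add: traversal_seg_def s_def)
  define k where "k = min j (i + length u)"
  have "length (u @ v) \<le> j - i" unfolding uv[symmetric] by simp
  then have k: "i \<le> k" "k \<le> j" "k = i + length u" using assms by (auto simp: k_def)
  have "take (length u) (drop i (take j s)) = u" "drop (length u) (drop i (take j s)) = v"
    by (simp_all add: uv)
  moreover have "take (length u) (drop i (take j s)) = drop i (take k s)"
    using k by (simp add: take_drop min_def add.commute)
  ultimately have "u = traversal_seg G i k" "v = traversal_seg G k j"
    using k by (auto simp: traversal_seg_def s_def[symmetric] add.commute)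
  then show "\<exists>k. i \<le> k \<and> k \<le> j \<and> u = traversal_seg G i k \<and> v = traversal_seg G k j"
    using k by blast
next
  assume "\<exists>k. i \<le> k \<and> k \<le> j \<and> u = traversal_seg G i k \<and> v = traversal_seg G k j"
  then obtain k where k: "i \<le> k" "k \<le> j" "u = traversal_seg G i k" "v = traversal_seg G k j"
    by blast
  define s where "s = biorder (number 0 G)"
  have "take j s = take k s @ drop k (take j s)"
    using k(2) by (metis append_take_drop_id min.absorb1 take_take)
  then show "traversal_seg G i j = u @ v"
  \<comment> \<open>The indices may exceed the length of the traversal; beyond its end the second
    segment is empty.\<close>
  proof (cases "k \<le> length s")
    case True
    then show ?thesis using k \<open>take j s = take k s @ drop k (take j s)\<close>
      by (simp add: traversal_seg_def s_def[symmetric])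
        (metis append_Nil2 append_take_drop_id assms diff_is_0_eq' drop0 drop_all drop_append length_take min.absorb2)
  qed (use k in \<open>simp add: traversal_seg_def s_def[symmetric]\<close>)
qed

lemma seq_align_append_seg:
  assumes "i \<le> j"
  shows "seq_align (F1 @ F2) (traversal_seg G i j) w \<longleftrightarrow>
    (\<exists>k w1 w2. i \<le> k \<and> k \<le> j \<and> seq_align F1 (traversal_seg G i k) w1 \<and>
      seq_align F2 (traversal_seg G k j) w2 \<and> w \<le> w1 + w2)"
  unfolding seq_align_append traversal_seg_split[OF assms] by blast

text \<open>Two equal entries in a segment are the two visits of one node, so the ways to split
  around such a pair are the nodes that lie entirely inside the range.\<close>

lemma traversal_seg_node:
  assumes "i \<le> j" "j \<le> 2 * fsize G"
  shows "(\<exists>u0 u2. traversal_seg G i j = u0 @ b # u1 @ b # u2) \<longleftrightarrow>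
    (\<exists>l r. (l, r, b) \<in> occs 0 (number 0 G) \<and> i \<le> l \<and> r < j \<and> u1 = traversal_seg G (Suc l) r)"
proof -
  define s where "s = biorder (number 0 G)"
  have len: "length s = 2 * fsize G" by (simp add: s_def length_biorder)
  have cons: "traversal_seg G k j = c # v \<longleftrightarrow> k < j \<and> s ! k = c \<and> v = traversal_seg G (Suc k) j"
    for k c v
    using assms(2) len by (cases "k < j") (auto simp: traversal_seg_def s_def[symmetric] Cons_nth_drop_Suc[symmetric])
  have split: "traversal_seg G k j = u @ c # v \<longleftrightarrow> (\<exists>l. k \<le> l \<and> l < j \<and> u = traversal_seg G k l \<and>
      s ! l = c \<and> v = traversal_seg G (Suc l) j)" if "k \<le> j" for k u c v
    unfolding traversal_seg_split[OF that] using cons by (metis less_or_eq_imp_le)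
  have "(\<exists>u0 u2. traversal_seg G i j = u0 @ b # u1 @ b # u2) \<longleftrightarrow>
    (\<exists>l. i \<le> l \<and> l < j \<and> s ! l = b \<and> (\<exists>u2. traversal_seg G (Suc l) j = u1 @ b # u2))"
    unfolding split[OF assms(1)] by metis
  also have "\<dots> \<longleftrightarrow> (\<exists>l r. i \<le> l \<and> l < r \<and> r < j \<and> s ! l = b \<and> s ! r = b \<and> u1 = traversal_seg G (Suc l) r)"
  proof -
    have "(\<exists>u2. traversal_seg G (Suc l) j = u1 @ b # u2) \<longleftrightarrow>
      (\<exists>r. l < r \<and> r < j \<and> s ! r = b \<and> u1 = traversal_seg G (Suc l) r)" if "l < j" for l
      using that by (auto simp: split Suc_le_eq)
    note E = this
    show ?thesis
    proof (rule ex_cong1)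
      fix l
      show "(i \<le> l \<and> l < j \<and> s ! l = b \<and> (\<exists>u2. traversal_seg G (Suc l) j = u1 @ b # u2)) \<longleftrightarrow>
        (\<exists>r. i \<le> l \<and> l < r \<and> r < j \<and> s ! l = b \<and> s ! r = b \<and> u1 = traversal_seg G (Suc l) r)"
        by (cases "l < j") (use E in blast, auto)
    qed
  qed
  also have "\<dots> \<longleftrightarrow> (\<exists>l r. (l, r, b) \<in> occs 0 (number 0 G) \<and> i \<le> l \<and> r < j \<and> u1 = traversal_seg G (Suc l) r)"
    unfolding occs_iff[OF count_list_biorder_number] fsize_number s_def[symmetric]
    using assms(2) by (intro ex_cong1) auto
  finally show ?thesis .
qed

lemma seq_align_root_seg:
  assumes "i \<le> j" "j \<le> 2 * fsize G"
  shows "seq_align [Node a cs] (traversal_seg G i j) w \<longleftrightarrow> seq_align cs (traversal_seg G i j) w \<or>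
    (\<exists>(l, r, b) \<in> occs 0 G. i \<le> l \<and> r < j \<and>
      (\<exists>w1. seq_align cs (traversal_seg G (Suc l) r) w1 \<and> w \<le> w1 + (if a = b then 2 else 1)))"
proof -
  \<comment> \<open>The triples can drop the numbers of the nodes, since the two positions already
    identify a node.\<close>
  have G: "occs 0 G = (\<lambda>(l, r, b). (l, r, snd b)) ` occs 0 (number 0 G)"
    by (simp add: occs_map[symmetric] map_snd_number)
  have "(\<exists>u0 b u1 u2 w1. traversal_seg G i j = u0 @ b # u1 @ b # u2 \<and> seq_align cs u1 w1 \<and>
      w \<le> w1 + (if a = snd b then 2 else 1)) \<longleftrightarrow>
    (\<exists>b u1. (\<exists>u0 u2. traversal_seg G i j = u0 @ b # u1 @ b # u2) \<and>
      (\<exists>w1. seq_align cs u1 w1 \<and> w \<le> w1 + (if a = snd b then 2 else 1)))" by blast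
  also have "\<dots> \<longleftrightarrow> (\<exists>(l, r, b) \<in> occs 0 G. i \<le> l \<and> r < j \<and>
      (\<exists>w1. seq_align cs (traversal_seg G (Suc l) r) w1 \<and> w \<le> w1 + (if a = b then 2 else 1)))"
    (is "?L \<longleftrightarrow> ?R")
  proof
    assume ?L
    then obtain b l r where "(l, r, b) \<in> occs 0 (number 0 G)" and *: "i \<le> l" "r < j"
      "\<exists>w1. seq_align cs (traversal_seg G (Suc l) r) w1 \<and> w \<le> w1 + (if a = snd b then 2 else 1)"
      unfolding traversal_seg_node[OF assms] by blast
    then have "(l, r, snd b) \<in> occs 0 G" unfolding G by force
    then show ?R using * by blast
  next
    assume ?R
    then obtain l r c where "(l, r, c) \<in> occs 0 G" and *: "i \<le> l" "r < j"
      "\<exists>w1. seq_align cs (traversal_seg G (Suc l) r) w1 \<and> w \<le> w1 + (if a = c then 2 else 1)"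
      by blast
    then obtain b where "(l, r, b) \<in> occs 0 (number 0 G)" "c = snd b" unfolding G by auto
    then show ?L unfolding traversal_seg_node[OF assms] using * by blast
  qed
  finally show ?thesis unfolding seq_align_root by blast
qed

lemma le_sim_matrix_iff:
  assumes "i \<le> 2 * fsize [T]" "j \<le> 2 * fsize [T]"
  shows "Some x \<le> sim_matrix F T $$ (i, j) \<longleftrightarrow> i \<le> j \<and> seq_align F (traversal_seg [T] i j) x"
  using assms by (auto simp: sim_matrix_def Let_def le_sim_subrange_iff)

text \<open>Each node of \<open>F\<close> is matched at most once, for a gain of at most 2. This
  limits the number of thresholds in a row, hence the passes of the product loops, and keeps all
  values within a word.\<close>

lemma seq_align_le: "seq_align F u w \<Longrightarrow> w \<le> 2 * fsize F"
  by (induction rule: seq_align.induct) (auto split: if_splits)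

section \<open>Reasoning about programs\<close>

lemma state_simps [simp]:
  "regs (tick k s) = regs s" "arrs (tick k s) = arrs s" "mats (tick k s) = mats s"
  "time (tick k s) = time s + k"
  "regs (set_reg r v s) = (regs s)(r := v)" "arrs (set_reg r v s) = arrs s"
  "mats (set_reg r v s) = mats s" "time (set_reg r v s) = time s"
  "regs (set_arr a p v s) = regs s" "arrs (set_arr a p v s) = (arrs s)(a := (arrs s a)(p := v))"
  "mats (set_arr a p v s) = mats s" "time (set_arr a p v s) = time s"
  "regs (set_mat h A s) = regs s" "arrs (set_mat h A s) = arrs s"
  "mats (set_mat h A s) = (mats s)(h := A)" "time (set_mat h A s) = time s"
  by (simp_all add: tick_def set_reg_def set_arr_def set_mat_def)

definition entry :: "vmat \<Rightarrow> nat \<Rightarrow> nat \<Rightarrow> nat" where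
  "entry A i j = (case A $$ (i, j) of None \<Rightarrow> 0 | Some v \<Rightarrow> v + 1)"

text \<open>The shift by one makes the answer of a query the number of thresholds that the entry
  meets. A loop counting from 0 up to it visits exactly the attained values, and none for
  \<open>-\<infinity>\<close>.\<close>

lemma less_entry_iff: "x < entry A i j \<longleftrightarrow> Some x \<le> A $$ (i, j)"
  by (auto simp: entry_def split: option.split)

locale ram =
  fixes W q :: nat and \<rho> :: "nat \<Rightarrow> nat"
begin

text \<open>Termination is included, and since the state carries the clock, running times are part
  of the postcondition.\<close>

definition wp :: "com \<Rightarrow> (state \<Rightarrow> bool) \<Rightarrow> state \<Rightarrow> bool" where
  "wp c Q s \<longleftrightarrow> (\<exists>s'. exec W q \<rho> c s s' \<and> Q s')"

lemma wp_simps [simp]: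
  "wp Skip Q s \<longleftrightarrow> Q (tick 1 s)"
  "wp (Assign r e) Q s \<longleftrightarrow> Q (tick (acost e + 1) (set_reg r (aval W s e) s))"
  "wp (Write a e1 e2) Q s \<longleftrightarrow>
     Q (tick (acost e1 + acost e2 + 1) (set_arr a (aval W s e1) (aval W s e2) s))"
  "wp (Seq c1 c2) Q s \<longleftrightarrow> wp c1 (wp c2 Q) s"
  "wp (Cond b c1 c2) Q s \<longleftrightarrow>
     (if bval W s b then wp c1 Q (tick (bcost b + 1) s) else wp c2 Q (tick (bcost b + 1) s))"
  "wp (Create h e1 e2) Q s \<longleftrightarrow> Q (tick (acost h + acost e1 + acost e2 + 1 + q)
       (set_mat (aval W s h) (neg_inf_mat (aval W s e1) (aval W s e2)) s))"
  "wp (Copy h h') Q s \<longleftrightarrow> Q (tick (acost h + acost h' + 1 + q)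
       (set_mat (aval W s h) (mats s (aval W s h')) s))"
  "wp (Rangemax h h' e1 e2 e3) Q s \<longleftrightarrow>
     aval W s e1 < dim_row (mats s (aval W s h')) \<and> aval W s e2 < dim_col (mats s (aval W s h')) \<and>
     Q (tick (acost h + acost h' + acost e1 + acost e2 + acost e3 + 1 + q)
       (set_mat (aval W s h)
         (rangemax (mats s (aval W s h')) (aval W s e1) (aval W s e2) (aval W s e3)) s))"
  "wp (Entry r h e1 e2) Q s \<longleftrightarrow>
     aval W s e1 < dim_row (mats s (aval W s h)) \<and> aval W s e2 < dim_col (mats s (aval W s h)) \<and>
     Q (tick (acost h + acost e1 + acost e2 + 1 + q)
       (set_reg r (entry (mats s (aval W s h)) (aval W s e1) (aval W s e2) mod W) s))"
  "wp (Mincol r h e1 e2) Q s \<longleftrightarrow> aval W s e1 < dim_row (mats s (aval W s h)) \<and>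
     Q (tick (acost h + acost e1 + acost e2 + 1 + q)
       (set_reg r
         (mincol (mats s (aval W s h)) (aval W s e1) (aval W s e2) (\<rho> (time s)) mod W) s))"
  unfolding wp_def entry_def
  subgoal by (fastforce elim: exec_elims intro: exec.intros)
  subgoal by (fastforce elim: exec_elims intro: exec.intros)
  subgoal by (fastforce elim: exec_elims intro: exec.intros)
  subgoal by (fastforce elim: exec_elims intro: exec.intros)
  subgoal
    by (auto elim!: exec_elims intro: exec.CondTrue[simplified] exec.CondFalse[simplified])
  subgoal
    by (rule iffI, (auto elim!: exec_elims)[1],
      intro exI conjI, rule exec.Create, assumption)
  subgoal
    by (rule iffI, (auto elim!: exec_elims)[1],
      intro exI conjI, rule exec.Copy, assumption)
  subgoal
    by (rule iffI, (auto elim!: exec_elims)[1],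
      elim conjE, intro exI conjI, rule exec.Rangemax[OF refl], assumption+)
  subgoal
    by (rule iffI, (auto elim!: exec_elims)[1],
      elim conjE, intro exI conjI, rule exec.Entry[OF refl], assumption+)
  subgoal
    by (rule iffI, (auto elim!: exec_elims)[1],
      elim conjE, intro exI conjI, rule exec.Mincol[OF refl], assumption+)
  done

lemma wp_While: "wp (While b c) Q s \<longleftrightarrow>
    (if bval W s b then wp c (wp (While b c) Q) (tick (bcost b + 1) s)
     else Q (tick (bcost b + 1) s))"
proof (cases "bval W s b")
  case True
  have "exec W q \<rho> (While b c) s s' \<longleftrightarrow>
    (\<exists>t. exec W q \<rho> c (tick (bcost b + 1) s) t \<and> exec W q \<rho> (While b c) t s')" for s'
    by (rule iffI, erule exec_WhileE, (use True in \<open>auto intro: exec.WhileTrue[simplified]\<close>))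
  then show ?thesis unfolding wp_def if_P[OF True] by blast
next
  case False
  have "exec W q \<rho> (While b c) s s' \<longleftrightarrow> s' = tick (bcost b + 1) s" for s'
    by (rule iffI, erule exec_WhileE)
      (use False exec.WhileFalse[OF False, of q \<rho> c] in auto)
  from this show ?thesis unfolding wp_def if_not_P[OF False] by simp
qed

lemma wp_mono: "wp c Q s \<Longrightarrow> (\<And>s'. Q s' \<Longrightarrow> Q' s') \<Longrightarrow> wp c Q' s"
  by (auto simp: wp_def)

text \<open>The number of passes is fixed in advance, so the index of the invariant also serves as
  the termination measure.\<close>

lemma wp_While_count:
  assumes "I k s" "k \<le> n"
    and "\<And>k s. k < n \<Longrightarrow> I k s \<Longrightarrow> bval W s b \<and> wp c (I (Suc k)) (tick (bcost b + 1) s)"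
    and "\<And>s. I n s \<Longrightarrow> \<not> bval W s b \<and> Q (tick (bcost b + 1) s)"
  shows "wp (While b c) Q s"
  using assms(1,2)
proof (induction "n - k" arbitrary: k s)
  case 0
  then show ?case using assms(4) by (subst wp_While) simp
next
  case (Suc d)
  then have "k < n" by simp
  from assms(3)[OF this Suc.prems(1)] have "bval W s b"
    "wp c (I (Suc k)) (tick (bcost b + 1) s)" by auto
  moreover have "wp (While b c) Q s'" if "I (Suc k) s'" for s'
    using Suc.hyps(1)[of "Suc k" s'] Suc.hyps(2) that \<open>k < n\<close> by simp
  ultimately show ?case by (subst wp_While) (auto elim: wp_mono)
qed

end

section \<open>Matrices described by thresholds\<close>

text \<open>Each entry is given by the set of numbers below it. A maximum becomes a disjunction and
  \<open>-\<infinity>\<close> the empty set, so no arithmetic with infinite entries occurs.\<close>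

definition mat_thr :: "vmat \<Rightarrow> nat \<Rightarrow> (nat \<Rightarrow> nat \<Rightarrow> nat \<Rightarrow> bool) \<Rightarrow> bool" where
  "mat_thr A N P \<longleftrightarrow> dim_row A = N \<and> dim_col A = N \<and>
     (\<forall>i<N. \<forall>j<N. \<forall>x. Some x \<le> A $$ (i, j) \<longleftrightarrow> P i j x)"

lemma mat_thr_cong:
  "mat_thr A N P \<Longrightarrow> (\<And>i j x. i < N \<Longrightarrow> j < N \<Longrightarrow> P i j x \<longleftrightarrow> P' i j x) \<Longrightarrow> mat_thr A N P'"
  by (auto simp: mat_thr_def)

lemma option_le_ext:
  fixes a b :: "nat option"
  assumes "\<And>x. Some x \<le> a \<longleftrightarrow> Some x \<le> b"
  shows "a = b"
  using assms by (cases a; cases b) (auto, metis dual_order.refl order_antisym)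

lemma mat_thr_unique: "mat_thr A N P \<Longrightarrow> mat_thr B N P \<Longrightarrow> A = B"
  by (rule eq_matI) (auto simp: mat_thr_def intro: option_le_ext)

lemma mat_thr_neg_inf: "mat_thr (neg_inf_mat N N) N (\<lambda>_ _ _. False)"
  by (auto simp: mat_thr_def neg_inf_mat_def)

lemma mat_thr_rangemax:
  "mat_thr A N P \<Longrightarrow>
    mat_thr (rangemax A i' j' v) N (\<lambda>i j x. P i j x \<or> i \<le> i' \<and> j' \<le> j \<and> x \<le> v)"
  by (auto simp: mat_thr_def rangemax_def le_max_iff_disj)

lemma less_entry_thr:
  "mat_thr A N P \<Longrightarrow> i < N \<Longrightarrow> j < N \<Longrightarrow> x < entry A i j \<longleftrightarrow> P i j x"
  by (auto simp: mat_thr_def less_entry_iff)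

definition first_col :: "(nat \<Rightarrow> nat \<Rightarrow> nat \<Rightarrow> bool) \<Rightarrow> nat \<Rightarrow> nat \<Rightarrow> nat" where
  "first_col P i x = (LEAST j. P i j x)"

lemma first_col:
  "P i j x \<Longrightarrow> P i (first_col P i x) x" "P i j x \<Longrightarrow> first_col P i x \<le> j"
  unfolding first_col_def by (auto intro: LeastI Least_le)

text \<open>The assumption \<open>P i j x\<close> says that the value is attained in the row; this
  excludes the arbitrary answer \<open>d\<close>.\<close>

lemma mincol_thr:
  assumes "mat_thr A N P" "i < N" "j < N" "P i j x"
  shows "mincol A i x d = first_col P i x"
proof -
  have *: "{j. j < dim_col A \<and> Some x \<le> A $$ (i, j)} = {j. j < N \<and> P i j x}"
    using assms(1,2) by (auto simp: mat_thr_def)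
  have "Min {j. j < N \<and> P i j x} = first_col P i x"
    using assms(3) first_col[of P i j x, OF assms(4)]
    by (intro Min_eqI) (auto intro: first_col(2))
  moreover have "\<exists>j<dim_col A. Some x \<le> A $$ (i, j)"
    using assms by (auto simp: mat_thr_def)
  ultimately show ?thesis by (simp add: mincol_def *)
qed

section \<open>The program\<close>

fun block :: "com list \<Rightarrow> com" where
  "block [] = Skip"
| "block (c # cs) = Seq c (block cs)"

definition incr :: "nat \<Rightarrow> com" where
  "incr r = Assign r (Plus (Reg r) (Const 1))"

abbreviation below :: aexp where "below \<equiv> Minus (Reg 5) (Const 1)"
abbreviation above :: aexp where "above \<equiv> Plus (Reg 5) (Const 1)"

text \<open>
  Registers 2 and 3 hold the last index and the dimension of the matrices, register 4 the position in
  the traversal of the forest, and register 5 the current depth \<open>d\<close>. Cell \<open>d\<close> holds the matrix of the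
  part of the current sibling list that has been read, and position \<open>d\<close> of array 2 the label code of
  the parent. When a node is left, the matrix of its tree is built in cell \<open>d + 1\<close>, cell \<open>d\<close> receives
  the product of the cells \<open>d - 1\<close> and \<open>d + 1\<close>, and is then copied to cell \<open>d - 1\<close>.
\<close>

definition init_loop :: com where
  "init_loop = While (Less (Reg 6) (Reg 3))
     (block [Rangemax (Reg 5) (Reg 5) (Reg 6) (Reg 6) (Const 0), incr 6])"

definition init :: com where
  "init = block [Create (Reg 5) (Reg 3) (Reg 3), Assign 6 (Const 0), init_loop]"

text \<open>
  The walk over the tree keeps in array 3 the positions of the entered nodes. The query for the matrix
  of the children reports its value plus one, which is already the weight for a root matched to a node
  with a different label.
\<close>

definition walk_body :: com where
  "walk_body = block
     [Cond (Less (Const 0) (Read 1 (Reg 6)))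
       (block [Write 3 (Reg 7) (Reg 6), incr 7])
       (block [Assign 7 (Minus (Reg 7) (Const 1)),
         Assign 8 (Read 3 (Reg 7)),
         Entry 9 (Reg 5) (Plus (Reg 8) (Const 1)) (Reg 6),
         Cond (Eq (Read 1 (Reg 8)) (Read 2 (Reg 5)))
           (Rangemax above above (Reg 8) (Plus (Reg 6) (Const 1)) (Plus (Reg 9) (Const 1)))
           (Rangemax above above (Reg 8) (Plus (Reg 6) (Const 1)) (Reg 9))]),
      incr 6]"

definition walk_loop :: com where
  "walk_loop = While (Less (Reg 6) (Plus (Reg 1) (Reg 1))) walk_body"

text \<open>The copy accounts for the alignments that remove the root. Later queries still go to the
  cell of the children and updates to the next one, so the root cannot be matched twice.\<close>

definition add_root :: com where
  "add_root = block [Copy above (Reg 5), Assign 6 (Const 0), Assign 7 (Const 0), walk_loop]"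

text \<open>Roles of the registers in the product: row in 6, left value in 11 with bound in 10,
  intermediate row in 12, right value in 14 with bound in 13, resulting column in 15. Both bounds
  are entries of the last column, the largest in their rows.\<close>

definition col_loop :: com where
  "col_loop = While (Less (Reg 14) (Reg 13))
     (block [Mincol 15 above (Reg 12) (Reg 14),
       Rangemax (Reg 5) (Reg 5) (Reg 6) (Reg 15) (Plus (Reg 11) (Reg 14)),
       incr 14])"

definition mid_loop :: com where
  "mid_loop = While (Less (Reg 11) (Reg 10))
     (block [Mincol 12 below (Reg 6) (Reg 11), Entry 13 above (Reg 12) (Reg 2),
       Assign 14 (Const 0), col_loop, incr 11])"

definition row_loop :: com where
  "row_loop = While (Less (Reg 6) (Reg 3))
     (block [Entry 10 below (Reg 6) (Reg 2), Assign 11 (Const 0), mid_loop, incr 6])"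

definition product :: com where
  "product = block [Create (Reg 5) (Reg 3) (Reg 3), Assign 6 (Const 0), row_loop]"

definition main_body :: com where
  "main_body = block
     [Cond (Less (Const 0) (Read 0 (Reg 4)))
       (block [incr 5, Write 2 (Reg 5) (Read 0 (Reg 4)), init])
       (block [add_root, product, Copy below (Reg 5), Assign 5 below]),
      incr 4]"

definition main_loop :: com where
  "main_loop = While (Less (Reg 4) (Plus (Reg 0) (Reg 0))) main_body"

definition sim_program :: com where
  "sim_program = block [Assign 2 (Plus (Reg 1) (Reg 1)), Assign 3 (Plus (Reg 2) (Const 1)),
     init, main_loop]"

context ram
begin

lemma wp_block [simp]:
  "wp (block []) Q s \<longleftrightarrow> Q (tick 1 s)"
  "wp (block (c # cs)) Q s \<longleftrightarrow> wp c (wp (block cs) Q) s"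
  by simp_all

lemma wp_incr [simp]:
  "wp (incr r) Q s \<longleftrightarrow> Q (tick 4 (set_reg r ((regs s r + 1 mod W) mod W) s))"
  by (simp add: incr_def eval_nat_numeral)

declare block.simps [simp del]

text \<open>The loops over a traversal are unfolded pass by pass instead of counted, because their
  proofs follow the recursion of the forest, with the rest of the loop as continuation.\<close>

lemma wp_walk_loop: "wp walk_loop Q s \<longleftrightarrow>
    (if regs s 6 < (regs s 1 + regs s 1) mod W then wp walk_body (wp walk_loop Q) (tick 6 s)
     else Q (tick 6 s))"
  unfolding walk_loop_def by (subst wp_While) (simp add: eval_nat_numeral)

lemma wp_main_loop: "wp main_loop Q s \<longleftrightarrow>
    (if regs s 4 < (regs s 0 + regs s 0) mod W then wp main_body (wp main_loop Q) (tick 6 s)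
     else Q (tick 6 s))"
  unfolding main_loop_def by (subst wp_While) (simp add: eval_nat_numeral)

end

section \<open>Correctness and running time\<close>

locale sim_machine = ram W q \<rho> for W q :: nat and \<rho> :: "nat \<Rightarrow> nat" +
  fixes T :: "'a rtree" and code :: "'a \<Rightarrow> nat" and n :: nat and L :: "'a set"
  assumes word_size: "8 * (n + fsize [T] + 1) \<le> W"
    and inj: "inj_on code L" and labels_T: "labels [T] \<subseteq> L"
begin

definition m :: nat where "m = fsize [T]"
definition N :: nat where "N = 2 * m + 1"
text \<open>Unit of all time bounds: the charge \<open>q\<close> of one matrix operation plus room
  for the ordinary operations around it.\<close>

definition U :: nat where "U = 20 + q"

abbreviation seg :: "nat \<Rightarrow> nat \<Rightarrow> (nat \<times> 'a) list" where
  "seg \<equiv> traversal_seg [T]"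

definition sim_ge :: "'a forest \<Rightarrow> nat \<Rightarrow> nat \<Rightarrow> nat \<Rightarrow> bool" where
  "sim_ge F i j x \<longleftrightarrow> i \<le> j \<and> seq_align F (seg i j) x"

lemma W_bound: "8 * n + 8 * m + 8 \<le> W"
  using word_size by (simp add: m_def)

lemma mat_thr_sim_matrix: "mat_thr (sim_matrix F T) N (sim_ge F)"
proof -
  have "dim_row (sim_matrix F T) = N" "dim_col (sim_matrix F T) = N"
    by (simp_all add: sim_matrix_def Let_def N_def m_def)
  then show ?thesis
    using le_sim_matrix_iff[of _ T _ _ F] by (simp add: mat_thr_def sim_ge_def N_def m_def)
qed

lemma sim_ge_Nil: "sim_ge [] i j x \<longleftrightarrow> i \<le> j \<and> x = 0"
  by (simp add: sim_ge_def seq_align_Nil)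

lemma sim_ge_le: "sim_ge F i j x \<Longrightarrow> x \<le> 2 * fsize F"
  unfolding sim_ge_def by (auto dest: seq_align_le)

lemma mod_W [simp]: "0 mod W = 0" "Suc 0 mod W = Suc 0"
  using W_bound by auto

text \<open>The empty forest has similarity 0 to every range. The operation at \<open>(l, l)\<close>
  reaches the entries with \<open>i \<le> l \<le> j\<close>, and over all \<open>l\<close> these
  make up the diagonal and everything above it.\<close>

lemma init_spec:
  assumes s: "regs s 3 = N" "regs s 5 = d"
    and Q: "\<And>s'. \<forall>r. r \<noteq> 6 \<longrightarrow> regs s' r = regs s r \<Longrightarrow> arrs s' = arrs s \<Longrightarrow>
      \<forall>g. g \<noteq> d \<longrightarrow> mats s' g = mats s g \<Longrightarrow> mat_thr (mats s' d) N (sim_ge []) \<Longrightarrow>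
      time s' \<le> time s + 4 * N * U \<Longrightarrow> Q s'"
  shows "wp init Q s"
proof -
  define I where "I k s' \<longleftrightarrow> (\<forall>r. r \<noteq> 6 \<longrightarrow> regs s' r = regs s r) \<and> regs s' 6 = k \<and> arrs s' = arrs s \<and>
    (\<forall>g. g \<noteq> d \<longrightarrow> mats s' g = mats s g) \<and>
    mat_thr (mats s' d) N (\<lambda>i j x. \<exists>l<k. i \<le> l \<and> l \<le> j \<and> x = 0) \<and>
    time s' \<le> time s + (1 + k) * U" for k and s' :: state
  have loop: "wp init_loop (wp (block []) Q) s0" if "I 0 s0" for s0
    unfolding init_loop_def
  proof (rule wp_While_count[where I = I and n = N, OF that])
    fix k s' assume k: "k < N" and I: "I k s'"
    then have *: "regs s' 3 = N" "regs s' 5 = d" "regs s' 6 = k" "dim_row (mats s' d) = N"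
      "dim_col (mats s' d) = N" "k + 1 < W" "k < W"
      using s W_bound by (auto simp: I_def N_def mat_thr_def)
    have "mat_thr (rangemax (mats s' d) k k 0) N (\<lambda>i j x. \<exists>l<Suc k. i \<le> l \<and> l \<le> j \<and> x = 0)"
      using I by (intro mat_thr_cong[OF mat_thr_rangemax]) (auto simp: I_def less_Suc_eq)
    then show "bval W s' (Less (Reg 6) (Reg 3)) \<and>
      wp (block [Rangemax (Reg 5) (Reg 5) (Reg 6) (Reg 6) (Const 0), incr 6]) (I (Suc k))
        (tick (bcost (Less (Reg 6) (Reg 3)) + 1) s')"
      using I * k by (simp add: I_def U_def)
  next
    fix s' assume I: "I N s'"
    then have "mat_thr (mats s' d) N (sim_ge [])"
      unfolding I_def by (auto simp: sim_ge_Nil elim!: mat_thr_cong)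
    moreover have "(1 + N) * U + 5 \<le> 4 * N * U"
      by (simp add: N_def U_def algebra_simps)
    ultimately show "\<not> bval W s' (Less (Reg 6) (Reg 3)) \<and>
      wp (block []) Q (tick (bcost (Less (Reg 6) (Reg 3)) + 1) s')"
      using I s by (auto simp: I_def intro!: Q)
  qed simp
  show ?thesis
    unfolding init_def using s mat_thr_neg_inf[of N]
    by (simp, intro loop) (simp add: I_def U_def)
qed

section \<open>Adding a root: the walk over the tree\<close>

lemma walk_enter:
  assumes s: "regs s 1 = m" "regs s 6 = p" "regs s 7 = h" "p < 2 * m" "h \<le> p" "arrs s 1 p > 0"
    and Q: "\<And>s'. \<forall>r. r \<notin> {6, 7} \<longrightarrow> regs s' r = regs s r \<Longrightarrow> regs s' 6 = p + 1 \<Longrightarrow>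
      regs s' 7 = h + 1 \<Longrightarrow> arrs s' = (arrs s)(3 := (arrs s 3)(h := p)) \<Longrightarrow> mats s' = mats s \<Longrightarrow>
      time s' \<le> time s + 3 * U \<Longrightarrow> wp walk_loop Q s'"
  shows "wp walk_loop Q s"
proof -
  have W: "Suc p < W" "Suc h < W" "p < W" "h < W" "2 * m < W" "p < (m + m) mod W"
    using s W_bound by auto
  show ?thesis
    using s W 
    by (subst wp_walk_loop) (simp add: walk_body_def, intro Q, auto simp: U_def)
qed

definition root_ge :: "'a \<Rightarrow> 'a forest \<Rightarrow> nat \<Rightarrow> nat \<Rightarrow> 'a \<Rightarrow> nat \<Rightarrow> nat \<Rightarrow> nat \<Rightarrow> bool" where
  "root_ge a cs l r b i j x \<longleftrightarrow> i \<le> l \<and> r < j \<and>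
     (\<exists>w1. seq_align cs (seg (Suc l) r) w1 \<and> x \<le> w1 + (if a = b then 2 else 1))"

text \<open>Only on leaving a node are both of its positions known. The entry at
  \<open>(l + 1, r)\<close> belongs to the range strictly between them, which is what remains for
  the children of the root.\<close>

lemma walk_leave:
  assumes s: "regs s 1 = m" "regs s 5 = d" "regs s 6 = r" "regs s 7 = h + 1" "h < W" "d + 1 < W"
      "r < 2 * m" "l < r" "arrs s 1 r = 0" "arrs s 3 h = l" "arrs s 1 l = code b + 1"
      "arrs s 2 d = code a + 1" "a \<in> L" "b \<in> L" "fsize cs \<le> n"
    and M: "mat_thr (mats s d) N (sim_ge cs)" "mat_thr (mats s (d + 1)) N P"
    and Q: "\<And>s'. \<forall>r. r \<notin> {6, 7, 8, 9} \<longrightarrow> regs s' r = regs s r \<Longrightarrow> regs s' 6 = r + 1 \<Longrightarrow>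
      regs s' 7 = h \<Longrightarrow> arrs s' = arrs s \<Longrightarrow> \<forall>g. g \<noteq> d + 1 \<longrightarrow> mats s' g = mats s g \<Longrightarrow>
      mat_thr (mats s' (d + 1)) N (\<lambda>i j x. P i j x \<or> root_ge a cs l r b i j x) \<Longrightarrow>
      time s' \<le> time s + 3 * U \<Longrightarrow> wp walk_loop Q s'"
  shows "wp walk_loop Q s"
proof -
  define e where "e = entry (mats s d) (Suc l) r"
  have e: "x < e \<longleftrightarrow> seq_align cs (seg (Suc l) r) x" for x
    unfolding e_def using less_entry_thr[OF M(1), of "Suc l" r x] s(7,8)
    by (simp add: sim_ge_def N_def)
  have e0: "0 < e" by (simp add: e seq_align_zero)
  moreover have "e - 1 \<le> 2 * fsize cs"
    using e0 e[of "e - 1"] by (auto dest: seq_align_le)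
  ultimately have W: "Suc r < W" "Suc l < W" "r < W" "l < W" "2 * m < W" "r < (m + m) mod W"
    "Suc e < W" "e < W"
    using s W_bound by auto
  have code: "code b = code a \<longleftrightarrow> a = b"
    using inj s(13,14) by (auto simp: inj_on_def)
  \<comment> \<open>The best choice of \<open>w1\<close> is \<open>e - 1\<close>, so all matches of
    the root with this node form one quadrant with a single value.\<close>
  have R: "root_ge a cs l r b = (\<lambda>i j x. i \<le> l \<and> Suc r \<le> j \<and> x \<le> (if a = b then Suc e else e))"
  proof (intro ext)
    fix i j x
    have "(\<exists>w1. w1 < e \<and> x \<le> w1 + (if a = b then 2 else 1)) \<longleftrightarrow> x \<le> (if a = b then Suc e else e)"
    proof
      assume "x \<le> (if a = b then Suc e else e)"
      then show "\<exists>w1. w1 < e \<and> x \<le> w1 + (if a = b then 2 else 1)"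
        using e0 by (intro exI[of _ "e - 1"]) auto
    qed (auto split: if_splits)
    then show "root_ge a cs l r b i j x \<longleftrightarrow> i \<le> l \<and> Suc r \<le> j \<and> x \<le> (if a = b then Suc e else e)"
      by (simp add: root_ge_def e Suc_le_eq)
  qed
  have thr: "mat_thr (rangemax (mats s (Suc d)) l (Suc r) (if a = b then Suc e else e)) N
      (\<lambda>i j x. P i j x \<or> root_ge a cs l r b i j x)"
    using mat_thr_rangemax[OF M(2)] by (simp add: R)
  have dims: "dim_row (mats s d) = N" "dim_col (mats s d) = N"
    "dim_row (mats s (Suc d)) = N" "dim_col (mats s (Suc d)) = N"
    using M by (auto simp: mat_thr_def)
  have idx: "Suc l < N" "l < N" "r < N" "Suc r < N" using s(7,8) by (auto simp: N_def)
  note facts = s W code dims idx e_def[symmetric]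
  show ?thesis
  proof (cases "a = b")
    case True
    then show ?thesis
      using facts 
      by (subst wp_walk_loop) (simp add: walk_body_def, intro Q,
        use thr in \<open>auto simp: U_def\<close>)
  next
    case False
    then show ?thesis
      using facts 
      by (subst wp_walk_loop) (simp add: walk_body_def, intro Q,
        use thr in \<open>auto simp: U_def\<close>)
  qed
qed

text \<open>In continuation form the statement can be chained: children, leaving their parent, later
  siblings. Stack positions below \<open>h\<close> are preserved, which is how the position of the
  parent is found again after its children were read.\<close>

lemma walk_forest:
  assumes s: "regs s 1 = m" "regs s 5 = d" "d + 1 < W" "regs s 6 = p" "regs s 7 = h" "h \<le> p"
      "p + 2 * fsize G \<le> 2 * m" "\<forall>k < 2 * fsize G. arrs s 1 (p + k) = encode code G ! k"
      "arrs s 2 d = code a + 1" "a \<in> L" "labels G \<subseteq> L" "fsize cs \<le> n"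
    and M: "mat_thr (mats s d) N (sim_ge cs)" "mat_thr (mats s (d + 1)) N P"
    and Q: "\<And>s'. \<forall>r. r \<notin> {6, 7, 8, 9} \<longrightarrow> regs s' r = regs s r \<Longrightarrow> regs s' 6 = p + 2 * fsize G \<Longrightarrow>
      regs s' 7 = h \<Longrightarrow> \<forall>b. b \<noteq> 3 \<longrightarrow> arrs s' b = arrs s b \<Longrightarrow> \<forall>k<h. arrs s' 3 k = arrs s 3 k \<Longrightarrow>
      \<forall>g. g \<noteq> d + 1 \<longrightarrow> mats s' g = mats s g \<Longrightarrow>
      mat_thr (mats s' (d + 1)) N
        (\<lambda>i j x. P i j x \<or> (\<exists>(l, r, b) \<in> occs p G. root_ge a cs l r b i j x)) \<Longrightarrow>
      time s' \<le> time s + 2 * fsize G * (3 * U) \<Longrightarrow> wp walk_loop Q s'"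
  shows "wp walk_loop Q s"
  using s M Q
proof (induction G arbitrary: s p h P rule: fsize.induct)
  case (1 s p h P)
  show ?case by (rule 1(15)) (use 1 in auto)
next
  case (2 b ds ts s p h P)
  note prems = 2(3-16)
  note Q = 2(17)
  note arr = prems(8)
  have arr1: "arrs s 1 p = code b + 1"
    using arr[rule_format, of 0] by simp
  have arr2: "arrs s 1 (p + 1 + k) = encode code ds ! k" if "k < 2 * fsize ds" for k
    using arr[rule_format, of "k + 1"] that by (simp add: nth_append length_encode)
  have arr3: "arrs s 1 (p + 1 + 2 * fsize ds) = 0"
    using arr[rule_format, of "1 + 2 * fsize ds"] by (simp add: nth_append length_encode)
  have arr4: "arrs s 1 (p + 2 + 2 * fsize ds + k) = encode code ts ! k" if "k < 2 * fsize ts" for k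
    using arr[rule_format, of "2 + 2 * fsize ds + k"] that by (simp add: nth_append length_encode add.assoc)
  have labels: "b \<in> L" "labels ds \<subseteq> L" "labels ts \<subseteq> L"
    using prems(11) by (auto simp: labels_def)
  show ?case
  proof (rule walk_enter)
    fix s1 :: state
    assume s1: "\<forall>r. r \<notin> {6, 7} \<longrightarrow> regs s1 r = regs s r" "regs s1 6 = p + 1" "regs s1 7 = h + 1"
      "arrs s1 = (arrs s)(3 := (arrs s 3)(h := p))" "mats s1 = mats s" "time s1 \<le> time s + 3 * U"
    show "wp walk_loop Q s1"
    proof (rule 2(1)[where p = "p + 1" and h = "h + 1" and P = P])
      fix s2 :: state
      assume s2: "\<forall>r. r \<notin> {6, 7, 8, 9} \<longrightarrow> regs s2 r = regs s1 r" "regs s2 6 = p + 1 + 2 * fsize ds"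
        "regs s2 7 = h + 1" "\<forall>b. b \<noteq> 3 \<longrightarrow> arrs s2 b = arrs s1 b"
        "\<forall>k<h + 1. arrs s2 3 k = arrs s1 3 k" "\<forall>g. g \<noteq> d + 1 \<longrightarrow> mats s2 g = mats s1 g"
        "mat_thr (mats s2 (d + 1)) N
          (\<lambda>i j x. P i j x \<or> (\<exists>(l, r, b) \<in> occs (p + 1) ds. root_ge a cs l r b i j x))"
        "time s2 \<le> time s1 + 2 * fsize ds * (3 * U)"
      show "wp walk_loop Q s2"
      proof (rule walk_leave[where r = "p + 1 + 2 * fsize ds" and l = p and h = h and b = b
            and a = a and cs = cs and d = d, OF _ _ _ _ _ _ _ _ _ _ _ _ _ _ _ _ s2(7)])
        fix s3 :: state
        assume s3: "\<forall>r. r \<notin> {6, 7, 8, 9} \<longrightarrow> regs s3 r = regs s2 r"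
          "regs s3 6 = p + 1 + 2 * fsize ds + 1"
          "regs s3 7 = h" "arrs s3 = arrs s2" "\<forall>g. g \<noteq> d + 1 \<longrightarrow> mats s3 g = mats s2 g"
          "mat_thr (mats s3 (d + 1)) N (\<lambda>i j x.
            (P i j x \<or> (\<exists>(l, r, b) \<in> occs (p + 1) ds. root_ge a cs l r b i j x)) \<or>
            root_ge a cs p (p + 1 + 2 * fsize ds) b i j x)"
          "time s3 \<le> time s2 + 3 * U"
        show "wp walk_loop Q s3"
        proof (rule 2(2)[where p = "p + 2 + 2 * fsize ds" and h = h, OF _ _ _ _ _ _ _ _ _ _ _ _ _ s3(6)])
          fix s4 :: state
          assume s4: "\<forall>r. r \<notin> {6, 7, 8, 9} \<longrightarrow> regs s4 r = regs s3 r"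
            "regs s4 6 = p + 2 + 2 * fsize ds + 2 * fsize ts"
            "regs s4 7 = h" "\<forall>b. b \<noteq> 3 \<longrightarrow> arrs s4 b = arrs s3 b"
            "\<forall>k<h. arrs s4 3 k = arrs s3 3 k" "\<forall>g. g \<noteq> d + 1 \<longrightarrow> mats s4 g = mats s3 g"
            "mat_thr (mats s4 (d + 1)) N (\<lambda>i j x.
              ((P i j x \<or> (\<exists>(l, r, b) \<in> occs (p + 1) ds. root_ge a cs l r b i j x)) \<or>
              root_ge a cs p (p + 1 + 2 * fsize ds) b i j x) \<or>
              (\<exists>(l, r, b) \<in> occs (p + 2 + 2 * fsize ds) ts. root_ge a cs l r b i j x))"
            "time s4 \<le> time s3 + 2 * fsize ts * (3 * U)"
          show "wp walk_loop Q s4"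
          proof (rule Q)
            show "mat_thr (mats s4 (d + 1)) N (\<lambda>i j x. P i j x \<or>
              (\<exists>(l, r, b) \<in> occs p (Node b ds # ts). root_ge a cs l r b i j x))"
              by (rule mat_thr_cong[OF s4(7)]) auto
            have "time s4 \<le> time s + (3 * U + 2 * fsize ds * (3 * U) + 3 * U + 2 * fsize ts * (3 * U))"
              using s1 s2 s3 s4 by linarith
            then show "time s4 \<le> time s + 2 * fsize (Node b ds # ts) * (3 * U)"
              by (simp add: algebra_simps)
          qed (use s1 s2 s3 s4 in auto)
        qed (use prems s1 s2 s3 labels arr4 in auto)
      qed (use prems s1 s2 labels arr1 arr3 W_bound in auto)
    qed (use prems s1 labels arr2 in auto)
  qed (use prems arr1 in auto)
qed

lemma U_ge: "20 \<le> U" "q + 20 \<le> U"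
  by (simp_all add: U_def)

text \<open>A larger range only adds entries that can be skipped. This is the row and column
  monotonicity of the similarity matrix.\<close>

lemma seq_align_seg_mono:
  assumes "seq_align F (seg i j) x" "i' \<le> i" "i \<le> j" "j \<le> j'"
  shows "seq_align F (seg i' j') x"
proof -
  have "seg i' j' = seg i' i @ seg i j @ seg j j'"
    using assms(2-4) traversal_seg_split[of i' j' "[T]" "seg i' i" "seg i j'"]
      traversal_seg_split[of i j' "[T]" "seg i j" "seg j j'"] by auto
  then show ?thesis
    using seq_align_subseq[OF assms(1)] by (metis list_emb_append2 list_emb_append_mono
        append_Nil2 list_emb_Nil subseq_order.order_refl)
qed

lemma sim_ge_mono: "sim_ge F i j x \<Longrightarrow> i' \<le> i \<Longrightarrow> j \<le> j' \<Longrightarrow> y \<le> x \<Longrightarrow> sim_ge F i' j' y"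
  unfolding sim_ge_def by (auto intro: seq_align_seg_mono seq_align_mono)

lemma add_root_spec:
  assumes s: "regs s 1 = m" "regs s 5 = d" "d + 1 < W"
      "\<forall>k < 2 * m. arrs s 1 k = encode code [T] ! k"
      "arrs s 2 d = code a + 1" "a \<in> L" "fsize cs \<le> n"
    and M: "mat_thr (mats s d) N (sim_ge cs)"
    and Q: "\<And>s'. \<forall>r. r \<notin> {6, 7, 8, 9} \<longrightarrow> regs s' r = regs s r \<Longrightarrow>
      \<forall>b. b \<noteq> 3 \<longrightarrow> arrs s' b = arrs s b \<Longrightarrow> \<forall>g. g \<noteq> d + 1 \<longrightarrow> mats s' g = mats s g \<Longrightarrow>
      mat_thr (mats s' (d + 1)) N (sim_ge [Node a cs]) \<Longrightarrow>
      time s' \<le> time s + 4 * N * U \<Longrightarrow> Q s'"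
  shows "wp add_root Q s"
proof -
  have loop: "wp walk_loop (wp (block []) Q) s0"
    if s0: "regs s0 = (regs s)(6 := 0, 7 := 0)" "arrs s0 = arrs s"
      "mats s0 = (mats s)(d + 1 := mats s d)" "time s0 = time s + q + 9" for s0
  proof (rule walk_forest[where p = 0 and h = 0 and G = "[T]" and P = "sim_ge cs"])
    fix s1 :: state
    assume s1: "\<forall>r. r \<notin> {6, 7, 8, 9} \<longrightarrow> regs s1 r = regs s0 r" "regs s1 6 = 0 + 2 * fsize [T]"
      "\<forall>b. b \<noteq> 3 \<longrightarrow> arrs s1 b = arrs s0 b" "\<forall>g. g \<noteq> d + 1 \<longrightarrow> mats s1 g = mats s0 g"
      "mat_thr (mats s1 (d + 1)) N
        (\<lambda>i j x. sim_ge cs i j x \<or> (\<exists>(l, r, b) \<in> occs 0 [T]. root_ge a cs l r b i j x))"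
      "time s1 \<le> time s0 + 2 * fsize [T] * (3 * U)"
    have "mat_thr (mats s1 (d + 1)) N (sim_ge [Node a cs])"
    proof (rule mat_thr_cong[OF s1(5)])
      fix i j x assume ij: "i < N" "j < N"
      show "sim_ge cs i j x \<or> (\<exists>(l, r, b) \<in> occs 0 [T]. root_ge a cs l r b i j x) \<longleftrightarrow>
        sim_ge [Node a cs] i j x"
      proof (cases "i \<le> j")
        case True
        then show ?thesis
          using seq_align_root_seg[of i j "[T]" a cs x] ij
          by (simp add: sim_ge_def root_ge_def N_def m_def)
      next
        case False
        then show ?thesis by (auto simp: sim_ge_def root_ge_def dest!: occs_bounds)
      qed
    qed
    moreover have "regs s1 6 = 2 * m" "regs s1 1 = m" "(m + m) mod W = 2 * m"
      using s1 s W_bound by (simp_all add: m_def s0)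
    moreover have "time s1 + 7 \<le> time s + 4 * N * U"
    proof -
      have "time s1 \<le> time s + (q + 9) + 6 * m * U"
        using s1(6) by (simp add: s0 m_def algebra_simps)
      moreover have "q + 16 + 6 * m * U \<le> 4 * N * U"
        by (simp add: N_def U_def algebra_simps)
      ultimately show ?thesis by linarith
    qed
    ultimately show "wp walk_loop (wp (block []) Q) s1"
      using s1 by (subst wp_walk_loop) (auto intro!: Q simp: s0)
  qed (use s M labels_T in \<open>auto simp: s0 m_def\<close>)
  then show ?thesis
    using s unfolding add_root_def by simp
qed

section \<open>The max-plus product of two similarity matrices\<close>

definition prod_ge :: "'a forest \<Rightarrow> 'a forest \<Rightarrow> nat \<Rightarrow> nat \<Rightarrow> nat \<Rightarrow> nat \<Rightarrow> nat \<Rightarrow> nat \<Rightarrow> bool" where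
  "prod_ge F1 F2 i' x y i j z \<longleftrightarrow> i \<le> i' \<and>
     first_col (sim_ge F2) (first_col (sim_ge F1) i' x) y \<le> j \<and> z \<le> x + y"

text \<open>
  By monotonicity it suffices to combine, in each row, the first columns at which the values of the
  left factor are attained.
\<close>

lemma sim_ge_append_iff:
  assumes "i < N" "j < N"
  shows "sim_ge (F1 @ F2) i j z \<longleftrightarrow> (\<exists>i'<N. \<exists>x y. sim_ge F1 i' (2 * m) x \<and>
    sim_ge F2 (first_col (sim_ge F1) i' x) (2 * m) y \<and> prod_ge F1 F2 i' x y i j z)"
proof
  assume *: "sim_ge (F1 @ F2) i j z"
  then obtain k x y where k: "i \<le> k" "k \<le> j" "sim_ge F1 i k x" "sim_ge F2 k j y" "z \<le> x + y"
    by (auto simp: sim_ge_def seq_align_append_seg)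
  let ?k = "first_col (sim_ge F1) i x"
  have "?k \<le> k" using first_col(2)[of "sim_ge F1"] k(3) .
  \<comment> \<open>Moving the cut left to the first possible column only enlarges the range left
    for \<open>F2\<close>.\<close>
  then have y: "sim_ge F2 ?k j y" using k(4) by (auto elim: sim_ge_mono)
  have "j \<le> 2 * m" using assms by (simp add: N_def)
  \<comment> \<open>A value attained anywhere in a row is attained in its last column, so the loop
    bounds read there lose nothing.\<close>
  then have "sim_ge F1 i (2 * m) x" "sim_ge F2 ?k (2 * m) y"
    using k y by (auto elim: sim_ge_mono)
  moreover have "prod_ge F1 F2 i x y i j z"
    using first_col(2)[of "sim_ge F2", OF y] k(5) by (simp add: prod_ge_def)
  ultimately show "\<exists>i'<N. \<exists>x y. sim_ge F1 i' (2 * m) x \<and>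
    sim_ge F2 (first_col (sim_ge F1) i' x) (2 * m) y \<and> prod_ge F1 F2 i' x y i j z"
    using assms by blast
next
  assume "\<exists>i'<N. \<exists>x y. sim_ge F1 i' (2 * m) x \<and>
    sim_ge F2 (first_col (sim_ge F1) i' x) (2 * m) y \<and> prod_ge F1 F2 i' x y i j z"
  then obtain i' x y where *: "sim_ge F1 i' (2 * m) x"
    "sim_ge F2 (first_col (sim_ge F1) i' x) (2 * m) y" "prod_ge F1 F2 i' x y i j z" by blast
  define k where "k = first_col (sim_ge F1) i' x"
  define l where "l = first_col (sim_ge F2) k y"
  have 1: "sim_ge F1 i' k x" "sim_ge F2 k l y"
    using first_col(1)[of "sim_ge F1", OF *(1)] first_col(1)[of "sim_ge F2", OF *(2)]
    by (simp_all add: k_def l_def)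
  then have le: "i' \<le> k" "k \<le> l" by (auto simp: sim_ge_def)
  with 1 have "sim_ge (F1 @ F2) i' l (x + y)"
    unfolding sim_ge_def seq_align_append_seg[OF order.trans[OF le]] by auto
  then show "sim_ge (F1 @ F2) i j z"
    using *(3) by (auto simp: prod_ge_def k_def l_def elim: sim_ge_mono)
qed

lemma col_loop_spec:
  assumes s: "regs s 5 = d" "regs s 6 = i'" "regs s 11 = x" "regs s 12 = k" "regs s 14 = 0"
      "regs s 13 = e" "d + 1 < W" "i' < N" "k < N" "x \<le> 2 * fsize F1"
      "fsize F1 + fsize F2 \<le> n" "\<forall>y. y < e \<longleftrightarrow> sim_ge F2 k (2 * m) y"
      "k = first_col (sim_ge F1) i' x"
    and M: "mat_thr (mats s (d + 1)) N (sim_ge F2)" "mat_thr (mats s d) N P"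
    and Q: "\<And>s'. \<forall>r. r \<notin> {14, 15} \<longrightarrow> regs s' r = regs s r \<Longrightarrow> arrs s' = arrs s \<Longrightarrow>
      \<forall>g. g \<noteq> d \<longrightarrow> mats s' g = mats s g \<Longrightarrow>
      mat_thr (mats s' d) N (\<lambda>i j z. P i j z \<or>
        (\<exists>y. sim_ge F2 k (2 * m) y \<and> prod_ge F1 F2 i' x y i j z)) \<Longrightarrow>
      time s' \<le> time s + (2 * e + 1) * U \<Longrightarrow> Q s'"
  shows "wp col_loop Q s"
proof -
  define I where "I y0 s' \<longleftrightarrow> (\<forall>r. r \<notin> {14, 15} \<longrightarrow> regs s' r = regs s r) \<and> regs s' 14 = y0 \<and>
    arrs s' = arrs s \<and> (\<forall>g. g \<noteq> d \<longrightarrow> mats s' g = mats s g) \<and>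
    mat_thr (mats s' d) N (\<lambda>i j z. P i j z \<or> (\<exists>y<y0. prod_ge F1 F2 i' x y i j z)) \<and>
    time s' \<le> time s + 2 * y0 * U" for y0 and s' :: state
  show ?thesis
    unfolding col_loop_def
  proof (rule wp_While_count[where I = I and n = e and k = 0])
    fix y s' assume y: "y < e" and I: "I y s'"
    then have y': "sim_ge F2 k (2 * m) y" using s by blast
    define j' where "j' = first_col (sim_ge F2) k y"
    have "j' \<le> 2 * m" unfolding j'_def by (rule first_col(2)[of "sim_ge F2", OF y'])
    moreover have "y \<le> 2 * fsize F2" using sim_ge_le[OF y'] .
    \<comment> \<open>\<open>x + y \<le> 2 * n\<close>, so the sum written by the program does not
      wrap around.\<close>
    ultimately have b: "j' < N" "j' < W" "y + 1 < W" "x + y < W" "i' < W" "k < W"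
      using s W_bound by (auto simp: N_def)
    have rg: "regs s' 5 = d" "regs s' 6 = i'" "regs s' 11 = x" "regs s' 12 = k" "regs s' 13 = e"
      "regs s' 14 = y" "mats s' (Suc d) = mats s (Suc d)" "dim_row (mats s' d) = N"
      "dim_col (mats s' d) = N" "dim_row (mats s (Suc d)) = N"
      using I s M by (auto simp: I_def mat_thr_def)
    have mc: "mincol (mats s (Suc d)) k y t = j'" for t
      unfolding j'_def using M(1) s(9) y' by (intro mincol_thr[where j = "2 * m"]) (auto simp: N_def)
    have "mat_thr (rangemax (mats s' d) i' j' (x + y)) N
        (\<lambda>i j z. P i j z \<or> (\<exists>y1<Suc y. prod_ge F1 F2 i' x y1 i j z))"
    proof (rule mat_thr_cong[OF mat_thr_rangemax])
      show "mat_thr (mats s' d) N (\<lambda>i j z. P i j z \<or> (\<exists>y1<y. prod_ge F1 F2 i' x y1 i j z))"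
        using I by (simp add: I_def)
    qed (auto simp: less_Suc_eq prod_ge_def j'_def s(13)[symmetric])
    then show "bval W s' (Less (Reg 14) (Reg 13)) \<and>
      wp (block [Mincol 15 above (Reg 12) (Reg 14),
          Rangemax (Reg 5) (Reg 5) (Reg 6) (Reg 15) (Plus (Reg 11) (Reg 14)), incr 14]) (I (Suc y))
        (tick (bcost (Less (Reg 14) (Reg 13)) + 1) s')"
      using I s(1-12) b y by (simp add: rg mc) (simp add: I_def U_def)
  next
    fix s' assume I: "I e s'"
    then have "mat_thr (mats s' d) N (\<lambda>i j z. P i j z \<or>
        (\<exists>y. sim_ge F2 k (2 * m) y \<and> prod_ge F1 F2 i' x y i j z))"
      using s(12) by (simp add: I_def)
    then show "\<not> bval W s' (Less (Reg 14) (Reg 13)) \<and>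
      Q (tick (bcost (Less (Reg 14) (Reg 13)) + 1) s')"
      using I s U_ge by (auto simp: I_def intro!: Q)
  qed (use s M in \<open>auto simp: I_def\<close>)
qed

lemma mid_loop_spec:
  assumes s: "regs s 2 = 2 * m" "regs s 5 = d + 1" "regs s 6 = i'" "regs s 11 = 0"
      "regs s 10 = e" "d + 2 < W" "i' < N" "fsize F1 + fsize F2 \<le> n"
      "\<forall>x. x < e \<longleftrightarrow> sim_ge F1 i' (2 * m) x"
    and M: "mat_thr (mats s d) N (sim_ge F1)" "mat_thr (mats s (d + 2)) N (sim_ge F2)"
      "mat_thr (mats s (d + 1)) N P"
    and Q: "\<And>s'. \<forall>r. r \<notin> {11, 12, 13, 14, 15} \<longrightarrow> regs s' r = regs s r \<Longrightarrow> arrs s' = arrs s \<Longrightarrow>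
      \<forall>g. g \<noteq> d + 1 \<longrightarrow> mats s' g = mats s g \<Longrightarrow>
      mat_thr (mats s' (d + 1)) N (\<lambda>i j z. P i j z \<or> (\<exists>x y. sim_ge F1 i' (2 * m) x \<and>
        sim_ge F2 (first_col (sim_ge F1) i' x) (2 * m) y \<and> prod_ge F1 F2 i' x y i j z)) \<Longrightarrow>
      time s' \<le> time s + e * ((2 * fsize F2 + 1) * (5 * U)) + U \<Longrightarrow> Q s'"
  shows "wp mid_loop Q s"
proof -
  \<comment> \<open>With \<open>g = 2 * fsize F2 + 1\<close>, the inner loop makes at most
    \<open>g\<close> passes and takes \<open>(2 * g + 1) * U\<close>, and the code around it at most
    \<open>2 * U\<close>. As \<open>1 \<le> g\<close>, the sum is at most
    \<open>5 * g * U\<close>.\<close>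
  define B where "B = (2 * fsize F2 + 1) * (5 * U)"
  define I where "I x0 s' \<longleftrightarrow> (\<forall>r. r \<notin> {11, 12, 13, 14, 15} \<longrightarrow> regs s' r = regs s r) \<and>
    regs s' 11 = x0 \<and> arrs s' = arrs s \<and> (\<forall>g. g \<noteq> d + 1 \<longrightarrow> mats s' g = mats s g) \<and>
    mat_thr (mats s' (d + 1)) N (\<lambda>i j z. P i j z \<or> (\<exists>x<x0. \<exists>y.
      sim_ge F2 (first_col (sim_ge F1) i' x) (2 * m) y \<and> prod_ge F1 F2 i' x y i j z)) \<and>
    time s' \<le> time s + x0 * B" for x0 and s' :: state
  show ?thesis
    unfolding mid_loop_def
  proof (rule wp_While_count[where I = I and n = e and k = 0])
    fix x s' assume x: "x < e" and I: "I x s'"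
    then have x': "sim_ge F1 i' (2 * m) x" using s by blast
    define k where "k = first_col (sim_ge F1) i' x"
    have "k \<le> 2 * m" unfolding k_def by (rule first_col(2)[of "sim_ge F1", OF x'])
    then have kN: "k < N" by (simp add: N_def)
    have xF: "x \<le> 2 * fsize F1" using sim_ge_le[OF x'] .
    define e2 where "e2 = entry (mats s (d + 2)) k (2 * m)"
    have e2: "y < e2 \<longleftrightarrow> sim_ge F2 k (2 * m) y" for y
      unfolding e2_def using less_entry_thr[OF M(2) kN] by (simp add: N_def)
    have "e2 \<le> 2 * fsize F2 + 1"
      using e2[of "e2 - 1"] sim_ge_le[of F2 k "2 * m" "e2 - 1"] by (cases "e2 = 0") auto
    moreover from this have b: "x + 1 < W" "i' < W" "k < W" "2 * m < W" "2 * m < N" "e2 < W"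
      using s xF kN W_bound by (auto simp: N_def)
    ultimately have e2B: "(2 * e2 + 1) * U + 2 * U \<le> B"
      using mult_le_mono1[of "2 * e2 + 3" "(2 * fsize F2 + 1) * 5" U] by (simp add: B_def algebra_simps)
    have rg: "regs s' 2 = 2 * m" "regs s' 5 = Suc d" "regs s' 6 = i'" "regs s' 10 = e"
      "regs s' 11 = x" "mats s' d = mats s d" "mats s' (Suc (Suc d)) = mats s (Suc (Suc d))"
      "dim_row (mats s d) = N" "dim_row (mats s (Suc (Suc d))) = N" "dim_col (mats s (Suc (Suc d))) = N"
      using I s M by (auto simp: I_def mat_thr_def)
    have mc: "mincol (mats s d) i' x t = k" for t
      unfolding k_def using M(1) s(7) x' by (intro mincol_thr[where j = "2 * m"]) (auto simp: N_def)
    have col: "wp col_loop (wp (block [incr 11]) (I (Suc x))) s0"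
      if s0: "\<forall>r. r \<notin> {12, 13, 14} \<longrightarrow> regs s0 r = regs s' r" "regs s0 12 = k" "regs s0 13 = e2"
        "regs s0 14 = 0" "arrs s0 = arrs s'" "mats s0 = mats s'" "time s0 = time s' + 18 + 2 * q" for s0
    proof (rule col_loop_spec[where d = "d + 1" and i' = i' and x = x and k = k and e = e2
          and ?F1.0 = F1 and ?F2.0 = F2])
      show "mat_thr (mats s0 (d + 1)) N (\<lambda>i j z. P i j z \<or> (\<exists>x1<x. \<exists>y.
          sim_ge F2 (first_col (sim_ge F1) i' x1) (2 * m) y \<and> prod_ge F1 F2 i' x1 y i j z))"
        using I s0 by (simp add: I_def)
      show "mat_thr (mats s0 (d + 1 + 1)) N (sim_ge F2)"
        using M s0 rg by simp
    next
      fix s1 :: state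
      assume s1: "\<forall>r. r \<notin> {14, 15} \<longrightarrow> regs s1 r = regs s0 r" "arrs s1 = arrs s0"
        "\<forall>g. g \<noteq> d + 1 \<longrightarrow> mats s1 g = mats s0 g"
        "mat_thr (mats s1 (d + 1)) N (\<lambda>i j z. (P i j z \<or> (\<exists>x1<x. \<exists>y.
          sim_ge F2 (first_col (sim_ge F1) i' x1) (2 * m) y \<and> prod_ge F1 F2 i' x1 y i j z)) \<or>
          (\<exists>y. sim_ge F2 k (2 * m) y \<and> prod_ge F1 F2 i' x y i j z))"
        "time s1 \<le> time s0 + (2 * e2 + 1) * U"
      have "mat_thr (mats s1 (d + 1)) N (\<lambda>i j z. P i j z \<or> (\<exists>x1<Suc x. \<exists>y.
          sim_ge F2 (first_col (sim_ge F1) i' x1) (2 * m) y \<and> prod_ge F1 F2 i' x1 y i j z))"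
        by (rule mat_thr_cong[OF s1(4)]) (auto simp: less_Suc_eq k_def)
      moreover have "time s1 + 5 \<le> time s + Suc x * B"
      proof -
        have "time s' \<le> time s + x * B" using I by (simp add: I_def)
        moreover have "time s1 \<le> time s' + 18 + 2 * q + (2 * e2 + 1) * U" using s0 s1 by simp
        moreover have "2 * q + 40 \<le> 2 * U" by (simp add: U_def)
        ultimately show ?thesis using e2B by simp
      qed
      moreover have "regs s1 11 = x" using s1 s0 rg by simp
      ultimately show "wp (block [incr 11]) (I (Suc x)) s1"
        using s0 s1 I b by (simp add: I_def)
    qed (use s0 rg s b kN xF e2 k_def in auto)
    show "bval W s' (Less (Reg 11) (Reg 10)) \<and>
      wp (block [Mincol 12 below (Reg 6) (Reg 11), Entry 13 above (Reg 12) (Reg 2),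
        Assign 14 (Const 0), col_loop, incr 11]) (I (Suc x))
        (tick (bcost (Less (Reg 11) (Reg 10)) + 1) s')"
      using s b x kN by (simp add: rg mc e2_def[simplified, symmetric]) (rule col, auto simp: rg)
  next
    fix s' assume I: "I e s'"
    then have "mat_thr (mats s' (d + 1)) N (\<lambda>i j z. P i j z \<or> (\<exists>x y. sim_ge F1 i' (2 * m) x \<and>
        sim_ge F2 (first_col (sim_ge F1) i' x) (2 * m) y \<and> prod_ge F1 F2 i' x y i j z))"
      using s(9) by (simp add: I_def)
    then show "\<not> bval W s' (Less (Reg 11) (Reg 10)) \<and>
      Q (tick (bcost (Less (Reg 11) (Reg 10)) + 1) s')"
      using I s U_ge by (auto simp: I_def B_def intro!: Q)
  qed (use s M in \<open>auto simp: I_def\<close>)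
qed

lemma product_spec:
  assumes s: "regs s 2 = 2 * m" "regs s 3 = N" "regs s 5 = d + 1" "d + 2 < W"
      "fsize F1 + fsize F2 \<le> n"
    and M: "mat_thr (mats s d) N (sim_ge F1)" "mat_thr (mats s (d + 2)) N (sim_ge F2)"
    and Q: "\<And>s'. \<forall>r. r \<notin> {6, 10, 11, 12, 13, 14, 15} \<longrightarrow> regs s' r = regs s r \<Longrightarrow>
      arrs s' = arrs s \<Longrightarrow> \<forall>g. g \<noteq> d + 1 \<longrightarrow> mats s' g = mats s g \<Longrightarrow>
      mat_thr (mats s' (d + 1)) N (sim_ge (F1 @ F2)) \<Longrightarrow>
      time s' \<le> time s + 9 * ((2 * fsize F1 + 1) * (2 * fsize F2 + 1)) * (N * U) \<Longrightarrow> Q s'"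
  shows "wp product Q s"
proof -
  define B where "B = (2 * fsize F1 + 1) * ((2 * fsize F2 + 1) * (5 * U)) + 2 * U"
  define I where "I k s' \<longleftrightarrow> (\<forall>r. r \<notin> {6, 10, 11, 12, 13, 14, 15} \<longrightarrow> regs s' r = regs s r) \<and>
    regs s' 6 = k \<and> arrs s' = arrs s \<and> (\<forall>g. g \<noteq> d + 1 \<longrightarrow> mats s' g = mats s g) \<and>
    mat_thr (mats s' (d + 1)) N (\<lambda>i j z. \<exists>i'<k. \<exists>x y. sim_ge F1 i' (2 * m) x \<and>
      sim_ge F2 (first_col (sim_ge F1) i' x) (2 * m) y \<and> prod_ge F1 F2 i' x y i j z) \<and>
    time s' \<le> time s + U + k * B" for k and s' :: state
  have loop: "wp row_loop (wp (block []) Q) s0" if "I 0 s0" for s0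
    unfolding row_loop_def
  proof (rule wp_While_count[where I = I and n = N, OF that])
    fix k s' assume k: "k < N" and I: "I k s'"
    define e where "e = entry (mats s d) k (2 * m)"
    have e: "x < e \<longleftrightarrow> sim_ge F1 k (2 * m) x" for x
      unfolding e_def using less_entry_thr[OF M(1) k] by (simp add: N_def)
    have e_le: "e \<le> 2 * fsize F1 + 1"
      using e[of "e - 1"] sim_ge_le[of F1 k "2 * m" "e - 1"] by (cases "e = 0") auto
    then have b: "k + 1 < W" "2 * m < W" "2 * m < N" "e < W"
      using s k W_bound by (auto simp: N_def)
    have rg: "regs s' 2 = 2 * m" "regs s' 3 = N" "regs s' 5 = Suc d" "regs s' 6 = k"
      "mats s' d = mats s d" "mats s' (Suc (Suc d)) = mats s (Suc (Suc d))"
      "dim_row (mats s d) = N" "dim_col (mats s d) = N"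
      using I s M by (auto simp: I_def mat_thr_def)
    have mid: "wp mid_loop (wp (block [incr 6]) (I (Suc k))) s0"
      if s0: "\<forall>r. r \<notin> {10, 11} \<longrightarrow> regs s0 r = regs s' r" "regs s0 10 = e" "regs s0 11 = 0"
        "arrs s0 = arrs s'" "mats s0 = mats s'" "time s0 = time s' + 12 + q" for s0
    proof (rule mid_loop_spec[where d = d and i' = k and e = e and ?F1.0 = F1 and ?F2.0 = F2])
      show "mat_thr (mats s0 (d + 1)) N (\<lambda>i j z. \<exists>i'<k. \<exists>x y. sim_ge F1 i' (2 * m) x \<and>
        sim_ge F2 (first_col (sim_ge F1) i' x) (2 * m) y \<and> prod_ge F1 F2 i' x y i j z)"
        using I s0 by (simp add: I_def)
    next
      fix s1 :: state
      assume s1: "\<forall>r. r \<notin> {11, 12, 13, 14, 15} \<longrightarrow> regs s1 r = regs s0 r" "arrs s1 = arrs s0"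
        "\<forall>g. g \<noteq> d + 1 \<longrightarrow> mats s1 g = mats s0 g"
        "mat_thr (mats s1 (d + 1)) N (\<lambda>i j z. (\<exists>i'<k. \<exists>x y. sim_ge F1 i' (2 * m) x \<and>
          sim_ge F2 (first_col (sim_ge F1) i' x) (2 * m) y \<and> prod_ge F1 F2 i' x y i j z) \<or>
          (\<exists>x y. sim_ge F1 k (2 * m) x \<and>
          sim_ge F2 (first_col (sim_ge F1) k x) (2 * m) y \<and> prod_ge F1 F2 k x y i j z))"
        "time s1 \<le> time s0 + e * ((2 * fsize F2 + 1) * (5 * U)) + U"
      have "mat_thr (mats s1 (d + 1)) N (\<lambda>i j z. \<exists>i'<Suc k. \<exists>x y. sim_ge F1 i' (2 * m) x \<and>
          sim_ge F2 (first_col (sim_ge F1) i' x) (2 * m) y \<and> prod_ge F1 F2 i' x y i j z)"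
        by (rule mat_thr_cong[OF s1(4)]) (auto simp: less_Suc_eq)
      moreover have "time s1 + 5 \<le> time s + U + Suc k * B"
      proof -
        have "time s' \<le> time s + U + k * B" using I by (simp add: I_def)
        moreover have "e * ((2 * fsize F2 + 1) * (5 * U)) + 2 * U \<le> B"
          unfolding B_def using e_le by (intro add_right_mono mult_le_mono1)
        moreover have "q + 20 \<le> U" by (simp add: U_def)
        ultimately show ?thesis using s0 s1 by simp
      qed
      moreover have "regs s1 6 = k" using s1 s0 rg by simp
      ultimately show "wp (block [incr 6]) (I (Suc k)) s1"
        using s0 s1 I b by (simp add: I_def)
    qed (use s0 rg s b k e M in auto)
    show "bval W s' (Less (Reg 6) (Reg 3)) \<and>
      wp (block [Entry 10 below (Reg 6) (Reg 2), Assign 11 (Const 0), mid_loop, incr 6]) (I (Suc k))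
        (tick (bcost (Less (Reg 6) (Reg 3)) + 1) s')"
      using s b k by (simp add: rg e_def[symmetric]) (rule mid, auto simp: rg)
  next
    fix s' assume I: "I N s'"
    then have "mat_thr (mats s' (d + 1)) N (sim_ge (F1 @ F2))"
      unfolding I_def by (elim conjE mat_thr_cong) (simp add: sim_ge_append_iff)
    moreover have "time s' + 5 \<le> time s + 9 * ((2 * fsize F1 + 1) * (2 * fsize F2 + 1)) * (N * U)"
    proof -
      define A where "A = (2 * fsize F1 + 1) * (2 * fsize F2 + 1)"
      have "time s' \<le> time s + U + N * (A * 5 * U + 2 * U)"
        using I by (simp only: I_def B_def A_def mult.assoc)
      \<comment> \<open>The factor 9 consists of 5 for the middle loops, 2 for the overhead per row,
        and 1 each for the start and the exit.\<close>
      moreover have "N * U \<le> A * (N * U)" "U \<le> N * U" by (auto simp: A_def N_def)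
      moreover have "N * (A * 5 * U + 2 * U) = 5 * (A * (N * U)) + 2 * (N * U)"
        by (simp add: algebra_simps)
      moreover have "9 * A * (N * U) = 9 * (A * (N * U))" by simp
      ultimately show ?thesis using U_ge unfolding A_def[symmetric] by linarith
    qed
    ultimately show "\<not> bval W s' (Less (Reg 6) (Reg 3)) \<and>
      wp (block []) Q (tick (bcost (Less (Reg 6) (Reg 3)) + 1) s')"
      using I s by (auto simp: I_def intro!: Q)
  qed simp
  show ?thesis
    unfolding product_def using s mat_thr_neg_inf[of N]
    by (simp, intro loop) (simp add: I_def U_def)
qed

section \<open>The traversal of the forest and the total time\<close>

lemma main_enter:
  assumes s: "regs s 0 = n" "regs s 3 = N" "regs s 4 = p" "regs s 5 = d" "p < 2 * n"
      "arrs s 0 p > 0" "d + 1 < W"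
    and Q: "\<And>s'. \<forall>r. r \<notin> {4, 5, 6} \<longrightarrow> regs s' r = regs s r \<Longrightarrow> regs s' 4 = p + 1 \<Longrightarrow>
      regs s' 5 = d + 1 \<Longrightarrow> arrs s' = (arrs s)(2 := (arrs s 2)(d + 1 := arrs s 0 p)) \<Longrightarrow>
      \<forall>g. g \<noteq> d + 1 \<longrightarrow> mats s' g = mats s g \<Longrightarrow> mat_thr (mats s' (d + 1)) N (sim_ge []) \<Longrightarrow>
      time s' \<le> time s + 6 * (N * U) \<Longrightarrow> wp main_loop Q s'"
  shows "wp main_loop Q s"
proof -
  have W: "Suc p < W" "p < W" "p < (n + n) mod W"
    using s W_bound by auto
  have U: "U \<le> N * U" by (simp add: N_def)
  have init: "wp init (wp (block []) (wp (block [incr 4]) (wp main_loop Q))) s0"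
    if s0: "\<forall>r. r \<noteq> 5 \<longrightarrow> regs s0 r = regs s r" "regs s0 5 = d + 1"
      "arrs s0 = (arrs s)(2 := (arrs s 2)(d + 1 := arrs s 0 p))" "mats s0 = mats s"
      "time s0 \<le> time s + 25" for s0
  proof (rule init_spec)
    show "regs s0 3 = N" "regs s0 5 = d + 1" using s s0 by auto
  next
    fix s1 :: state
    assume s1: "\<forall>r. r \<noteq> 6 \<longrightarrow> regs s1 r = regs s0 r" "arrs s1 = arrs s0"
      "\<forall>g. g \<noteq> d + 1 \<longrightarrow> mats s1 g = mats s0 g" "mat_thr (mats s1 (d + 1)) N (sim_ge [])"
      "time s1 \<le> time s0 + 4 * N * U"
    have "time s1 + 6 \<le> time s + 6 * (N * U)"
      using s0(5) s1(5) U U_ge unfolding mult.assoc by linarith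
    then show "wp (block []) (wp (block [incr 4]) (wp main_loop Q)) s1"
      using s s0 s1 W by (simp, intro Q) auto
  qed
  show ?thesis
    using s W by (subst wp_main_loop) (simp add: main_body_def, rule init, auto)
qed

lemma main_leave:
  assumes s: "regs s 0 = n" "regs s 1 = m" "regs s 2 = 2 * m" "regs s 3 = N" "regs s 4 = p"
      "regs s 5 = d + 1" "p < 2 * n" "arrs s 0 p = 0" "d + 2 < W"
      "\<forall>k < 2 * m. arrs s 1 k = encode code [T] ! k" "arrs s 2 (d + 1) = code a + 1" "a \<in> L"
      "fsize F0 + fsize cs + 1 \<le> n"
    and M: "mat_thr (mats s d) N (sim_ge F0)" "mat_thr (mats s (d + 1)) N (sim_ge cs)"
    and Q: "\<And>s'. \<forall>r<4. regs s' r = regs s r \<Longrightarrow> regs s' 4 = p + 1 \<Longrightarrow>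
      regs s' 5 = d \<Longrightarrow> \<forall>b. b \<noteq> 3 \<longrightarrow> arrs s' b = arrs s b \<Longrightarrow> \<forall>g<d. mats s' g = mats s g \<Longrightarrow>
      mat_thr (mats s' d) N (sim_ge (F0 @ [Node a cs])) \<Longrightarrow>
      time s' \<le> time s + 16 * ((2 * fsize F0 + 1) * (2 * fsize cs + 3) * (N * U)) \<Longrightarrow>
      wp main_loop Q s'"
  shows "wp main_loop Q s"
proof -
  have W: "Suc p < W" "p < W" "p < (n + n) mod W" "Suc d < W" "d < W"
    using s W_bound by auto
  have fs: "2 * fsize [Node a cs] + 1 = 2 * fsize cs + 3" by simp
  define A where "A = (2 * fsize F0 + 1) * (2 * fsize cs + 3) * (N * U)"
  have A: "9 * ((2 * fsize F0 + 1) * (2 * fsize [Node a cs] + 1)) * (N * U) = 9 * A"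
    by (simp only: fs A_def mult.assoc)
  have U: "U \<le> N * U" "N * U \<le> A" by (simp_all add: N_def A_def)
  let ?rest = "block [Copy below (Reg 5), Assign 5 below]"
  let ?Q' = "wp (block [incr 4]) (wp main_loop Q)"
  have root: "wp add_root (wp (block [product, Copy below (Reg 5), Assign 5 below]) ?Q') s0"
    if s0: "regs s0 = regs s" "arrs s0 = arrs s" "mats s0 = mats s" "time s0 = time s + 11" for s0
  proof (rule add_root_spec[where d = "d + 1" and a = a and cs = cs])
    fix s1 :: state
    assume s1: "\<forall>r. r \<notin> {6, 7, 8, 9} \<longrightarrow> regs s1 r = regs s0 r"
      "\<forall>b. b \<noteq> 3 \<longrightarrow> arrs s1 b = arrs s0 b" "\<forall>g. g \<noteq> d + 1 + 1 \<longrightarrow> mats s1 g = mats s0 g"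
      "mat_thr (mats s1 (d + 1 + 1)) N (sim_ge [Node a cs])"
      "time s1 \<le> time s0 + 4 * N * U"
    have "wp product (wp ?rest ?Q') s1"
    proof (rule product_spec[where d = d and ?F1.0 = F0 and ?F2.0 = "[Node a cs]"])
      show "mat_thr (mats s1 d) N (sim_ge F0)" using s1 s0 M by simp
      show "mat_thr (mats s1 (d + 2)) N (sim_ge [Node a cs])" using s1 by simp
    next
      fix s2 :: state
      assume s2: "\<forall>r. r \<notin> {6, 10, 11, 12, 13, 14, 15} \<longrightarrow> regs s2 r = regs s1 r"
        "arrs s2 = arrs s1" "\<forall>g. g \<noteq> d + 1 \<longrightarrow> mats s2 g = mats s1 g"
        "mat_thr (mats s2 (d + 1)) N (sim_ge (F0 @ [Node a cs]))"
        "time s2 \<le> time s1 + 9 * ((2 * fsize F0 + 1) * (2 * fsize [Node a cs] + 1)) * (N * U)"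
      \<comment> \<open>9 for the product, 4 for adding the root and 2 for the copy and the
        remaining code stay below 16.\<close>
      have t: "time s2 + q + 20 \<le> time s + 16 * A"
      proof -
        have "time s1 \<le> time s0 + 4 * (N * U)" using s1(5) by (simp only: mult.assoc)
        moreover have "time s2 \<le> time s1 + 9 * A" using s2(5) by (simp only: A)
        moreover have "q + 31 \<le> U + U" by (simp add: U_def)
        ultimately show ?thesis using s0(4) U by linarith
      qed
      show "wp ?rest ?Q' s2"
        using s s0 s1 s2 W t unfolding A_def
        by (simp, intro Q) auto
    qed (use s s0 s1 in auto)
    then show "wp (block [product, Copy below (Reg 5), Assign 5 below]) ?Q' s1" by simp
  qed (use s s0 M in auto)
  show ?thesis
    using s W by (subst wp_main_loop) (simp add: main_body_def, rule root[simplified], auto)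
qed

text \<open>
  Appending a tree with \<open>t\<close> nodes to a forest with \<open>f\<close> nodes costs a multiple of
  \<open>(2 * f + 1) * (2 * t + 1)\<close>. The potential \<open>4 * (f + t)\<^sup>2\<close> pays for it: it exceeds the potentials
  of the forest and of the \<open>t - 1\<close> nodes below the root by \<open>8 * f * t + 8 * t - 4\<close>.
\<close>

lemma main_loop_forest:
  assumes "regs s 0 = n" "regs s 1 = m" "regs s 2 = 2 * m" "regs s 3 = N" "regs s 4 = p"
      "regs s 5 = d" "p + 2 * fsize G \<le> 2 * n" "fsize F0 + fsize G \<le> n" "d + fsize G \<le> n"
      "\<forall>k < 2 * fsize G. arrs s 0 (p + k) = encode code G ! k"
      "\<forall>k < 2 * m. arrs s 1 k = encode code [T] ! k" "labels G \<subseteq> L"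
      "mat_thr (mats s d) N (sim_ge F0)"
    and "\<And>s'. \<forall>r<4. regs s' r = regs s r \<Longrightarrow> regs s' 4 = p + 2 * fsize G \<Longrightarrow>
      regs s' 5 = d \<Longrightarrow> \<forall>b<2. arrs s' b = arrs s b \<Longrightarrow> \<forall>k\<le>d. arrs s' 2 k = arrs s 2 k \<Longrightarrow>
      \<forall>g<d. mats s' g = mats s g \<Longrightarrow> mat_thr (mats s' d) N (sim_ge (F0 @ G)) \<Longrightarrow>
      time s' + 4 * (fsize F0)\<^sup>2 * (20 * N * U) \<le>
        time s + 4 * (fsize F0 + fsize G)\<^sup>2 * (20 * N * U) \<Longrightarrow> wp main_loop Q s'"
  shows "wp main_loop Q s"
  using assms
proof (induction G arbitrary: s p d F0 rule: fsize.induct)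
  case (1 s p d F0)
  show ?case by (rule 1(14)) (use 1 in auto)
next
  case (2 a cs ts s p d F0)
  note prems = 2(3-15)
  note Q = 2(16)
  note arr = prems(10)
  have arr1: "arrs s 0 p = code a + 1"
    using arr[rule_format, of 0] by simp
  have arr2: "arrs s 0 (p + 1 + k) = encode code cs ! k" if "k < 2 * fsize cs" for k
    using arr[rule_format, of "k + 1"] that by (simp add: nth_append length_encode)
  have arr3: "arrs s 0 (p + 1 + 2 * fsize cs) = 0"
    using arr[rule_format, of "1 + 2 * fsize cs"] by (simp add: nth_append length_encode)
  have arr4: "arrs s 0 (p + 2 + 2 * fsize cs + k) = encode code ts ! k" if "k < 2 * fsize ts" for k
    using arr[rule_format, of "2 + 2 * fsize cs + k"] that by (simp add: nth_append length_encode add.assoc)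
  have labels: "a \<in> L" "labels cs \<subseteq> L" "labels ts \<subseteq> L"
    using prems(12) by (auto simp: labels_def)
  have dW: "d + 2 < W" using prems(9) W_bound by simp
  define f where "f = fsize F0"
  define g where "g = fsize cs"
  define t where "t = fsize ts"
  define K where "K = N * U"
  have K_eq: "4 * x * (20 * N * U) = (80 * x) * K" for x
    by (simp add: K_def algebra_simps)
  have sum_eq: "f + fsize (Node a cs # ts) = f + g + 1 + t"
    by (simp add: g_def t_def)
  show ?case
  proof (rule main_enter[where p = p and d = d])
    fix s1 :: state
    assume s1: "\<forall>r. r \<notin> {4, 5, 6} \<longrightarrow> regs s1 r = regs s r" "regs s1 4 = p + 1"
      "regs s1 5 = d + 1" "arrs s1 = (arrs s)(2 := (arrs s 2)(d + 1 := arrs s 0 p))"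
      "\<forall>g. g \<noteq> d + 1 \<longrightarrow> mats s1 g = mats s g" "mat_thr (mats s1 (d + 1)) N (sim_ge [])"
      "time s1 \<le> time s + 6 * (N * U)"
    show "wp main_loop Q s1"
    \<comment> \<open>The children form a sibling list of their own in cell \<open>d + 1\<close>,
      started from the empty forest, whose potential is 0.\<close>
    proof (rule 2(1)[where p = "p + 1" and d = "d + 1", OF _ _ _ _ _ _ _ _ _ _ _ _ s1(6)])
      fix s2 :: state
      assume s2: "\<forall>r<4. regs s2 r = regs s1 r" "regs s2 4 = p + 1 + 2 * fsize cs"
        "regs s2 5 = d + 1" "\<forall>b<2. arrs s2 b = arrs s1 b" "\<forall>k\<le>d + 1. arrs s2 2 k = arrs s1 2 k"
        "\<forall>g<d + 1. mats s2 g = mats s1 g" "mat_thr (mats s2 (d + 1)) N (sim_ge ([] @ cs))"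
        "time s2 + 4 * (fsize ([] :: 'a forest))\<^sup>2 * (20 * N * U) \<le>
          time s1 + 4 * (fsize ([] :: 'a forest) + fsize cs)\<^sup>2 * (20 * N * U)"
      show "wp main_loop Q s2"
      proof (rule main_leave[where p = "p + 1 + 2 * fsize cs" and d = d and a = a and cs = cs
            and ?F0.0 = F0])
        show "mat_thr (mats s2 d) N (sim_ge F0)" using s1 s2 prems(13) by simp
        show "mat_thr (mats s2 (d + 1)) N (sim_ge cs)" using s2 by simp
      next
        fix s3 :: state
        assume s3: "\<forall>r<4. regs s3 r = regs s2 r" "regs s3 4 = p + 1 + 2 * fsize cs + 1"
          "regs s3 5 = d" "\<forall>b. b \<noteq> 3 \<longrightarrow> arrs s3 b = arrs s2 b" "\<forall>g<d. mats s3 g = mats s2 g"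
          "mat_thr (mats s3 d) N (sim_ge (F0 @ [Node a cs]))"
          "time s3 \<le> time s2 + 16 * ((2 * fsize F0 + 1) * (2 * fsize cs + 3) * (N * U))"
        show "wp main_loop Q s3"
        proof (rule 2(2)[where p = "p + 2 + 2 * fsize cs" and d = d and ?F0.0 = "F0 @ [Node a cs]",
              OF _ _ _ _ _ _ _ _ _ _ _ _ s3(6)])
          fix s4 :: state
          assume s4: "\<forall>r<4. regs s4 r = regs s3 r"
            "regs s4 4 = p + 2 + 2 * fsize cs + 2 * fsize ts" "regs s4 5 = d"
            "\<forall>b<2. arrs s4 b = arrs s3 b" "\<forall>k\<le>d. arrs s4 2 k = arrs s3 2 k"
            "\<forall>g<d. mats s4 g = mats s3 g"
            "mat_thr (mats s4 d) N (sim_ge ((F0 @ [Node a cs]) @ ts))"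
            "time s4 + 4 * (fsize (F0 @ [Node a cs]))\<^sup>2 * (20 * N * U) \<le>
              time s3 + 4 * (fsize (F0 @ [Node a cs]) + fsize ts)\<^sup>2 * (20 * N * U)"
          show "wp main_loop Q s4"
          proof (rule Q)
            have t1: "time s1 \<le> time s + 6 * K" using s1(7) by (simp add: K_def)
            have t2: "time s2 \<le> time s1 + (80 * g\<^sup>2) * K"
              using s2(8) by (simp add: K_def g_def)
            have t3: "time s3 \<le> time s2 + (16 * ((2 * f + 1) * (2 * g + 3))) * K"
              using s3(7) by (simp only: K_def g_def f_def mult.assoc)
            have t4: "time s4 + (80 * (f + g + 1)\<^sup>2) * K \<le> time s3 + (80 * (f + g + 1 + t)\<^sup>2) * K"
              using s4(8) by (simp add: K_def g_def f_def t_def add.assoc add.commute)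
            \<comment> \<open>Beyond \<open>80 * f\<^sup>2 + 80 * g\<^sup>2\<close> the right side
              has \<open>160 * (f * g + f + g) + 80\<close>, the left side
              \<open>64 * f * g + 96 * f + 32 * g + 54\<close>. The factor 20 on the potential
              provides this margin.\<close>
            have "80 * f\<^sup>2 + 6 + 80 * g\<^sup>2 + 16 * ((2 * f + 1) * (2 * g + 3)) \<le> 80 * (f + g + 1)\<^sup>2"
              by (simp add: power2_eq_square algebra_simps)
            from mult_le_mono1[OF this, of K]
            have "(80 * f\<^sup>2) * K + 6 * K + (80 * g\<^sup>2) * K + (16 * ((2 * f + 1) * (2 * g + 3))) * K \<le>
                (80 * (f + g + 1)\<^sup>2) * K"
              by (simp only: add_mult_distrib)
            with t1 t2 t3 t4
            have "time s4 + (80 * f\<^sup>2) * K \<le> time s + (80 * (f + g + 1 + t)\<^sup>2) * K" by linarith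
            then show "time s4 + 4 * (fsize F0)\<^sup>2 * (20 * N * U) \<le>
                time s + 4 * (fsize F0 + fsize (Node a cs # ts))\<^sup>2 * (20 * N * U)"
              unfolding K_eq f_def[symmetric] sum_eq .
          qed (use s1 s2 s3 s4 in auto)
        qed (use prems s1 s2 s3 labels arr4 in auto)
      qed (use prems s1 s2 labels arr1 arr3 dW in auto)
    qed (use prems s1 labels arr2 in auto)
  qed (use prems arr1 dW in auto)
qed

text \<open>\<open>max 1 n\<close> keeps the bound valid for the empty forest, where the
  \<open>N\<close> range operations that fill the initial matrix remain.\<close>

lemma sim_program_spec:
  assumes "n = fsize F" "labels F \<subseteq> L"
  shows "wp sim_program (\<lambda>s'. mats s' 0 = sim_matrix F T \<and>
    time s' \<le> 300 * ((max 1 n)\<^sup>2 * m * U)) (input_state code F [T])"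
proof -
  let ?s = "input_state code F [T]"
  define Q where "Q = (\<lambda>s' :: state. mats s' 0 = sim_matrix F T \<and>
    time s' \<le> 300 * ((max 1 n)\<^sup>2 * m * U))"
  have m1: "1 \<le> m" unfolding m_def by (cases T) simp
  have init: "wp init (wp (block [main_loop]) Q) s0"
    if s0: "regs s0 = (regs ?s)(2 := 2 * m, 3 := N)" "arrs s0 = arrs ?s" "time s0 = 8" for s0
  proof (rule init_spec[where d = 0])
    fix s1 :: state
    assume s1: "\<forall>r. r \<noteq> 6 \<longrightarrow> regs s1 r = regs s0 r" "arrs s1 = arrs s0"
      "mat_thr (mats s1 0) N (sim_ge [])" "time s1 \<le> time s0 + 4 * N * U"
    have "wp main_loop (wp (block []) Q) s1"
    proof (rule main_loop_forest[where p = 0 and d = 0 and G = F and ?F0.0 = "[]"])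
      fix s2 :: state
      assume s2: "\<forall>r<4. regs s2 r = regs s1 r" "regs s2 4 = 0 + 2 * fsize F"
        "mat_thr (mats s2 0) N (sim_ge ([] @ F))"
        "time s2 + 4 * (fsize ([] :: 'a forest))\<^sup>2 * (20 * N * U) \<le>
          time s1 + 4 * (fsize ([] :: 'a forest) + fsize F)\<^sup>2 * (20 * N * U)"
      have "mats s2 0 = sim_matrix F T"
        using mat_thr_unique[OF s2(3)] mat_thr_sim_matrix[of F] by simp
      moreover have "regs s2 0 = n" using s0 s1 s2 assms by (simp add: input_state_def)
      moreover have "time s2 + 7 \<le> 300 * ((max 1 n)\<^sup>2 * m * U)"
      proof -
        define M where "M = (max 1 n)\<^sup>2"
        have nM: "n\<^sup>2 \<le> M" "1 \<le> M" by (simp_all add: M_def power_mono)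
        have N3: "N \<le> 3 * m" using m1 by (simp add: N_def)
        have "time s2 \<le> 8 + 4 * (N * U) + 80 * (n\<^sup>2 * (N * U))"
          using s0 s1 s2 assms by (simp add: mult.assoc)
        moreover have "N * U \<le> M * (N * U)" "n\<^sup>2 * (N * U) \<le> M * (N * U)"
          using mult_le_mono1[OF nM(2), of "N * U"] mult_le_mono1[OF nM(1), of "N * U"] by auto
        moreover have "20 \<le> N * U" using U_ge by (simp add: N_def)
        \<comment> \<open>80 from the potential, 4 from the initial matrix, and 1 for the constants,
          as \<open>15 \<le> N * U\<close>. Then \<open>N \<le> 3 * m\<close> gives 255, rounded up
          to 300.\<close>
        ultimately have "time s2 + 7 \<le> 85 * (M * (N * U))" by linarith
        also have "\<dots> \<le> 85 * (M * (3 * m * U))"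
          using N3 by (intro mult_le_mono) auto
        also have "\<dots> \<le> 300 * (M * m * U)" by simp
        finally show ?thesis unfolding M_def .
      qed
      ultimately show "wp main_loop (wp (block []) Q) s2"
        using s2 assms W_bound by (subst wp_main_loop) (auto simp: Q_def)
    qed (use s0 s1 assms labels_T in
        \<open>auto simp: input_state_def m_def input_array_def length_encode simp del: encode.simps\<close>)
    then show "wp (block [main_loop]) Q s1" by simp
  qed (use s0 in \<open>auto simp: input_state_def\<close>)
  show ?thesis
    unfolding sim_program_def Q_def[symmetric] using W_bound
    by (simp, intro init) (auto simp: input_state_def m_def N_def)
qed

end

theorem theorem3:
  shows "\<exists>(P :: com) (c :: nat). \<forall>\<kappa>. subpolynomial \<kappa> \<longrightarrow>
    (\<exists>\<phi>. subpolynomial \<phi> \<and>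
      (\<forall>(F :: 'a forest) (T2 :: 'a rtree) (code :: 'a \<Rightarrow> nat) (W :: nat) (\<rho> :: nat \<Rightarrow> nat).
         inj_on code (labels F \<union> labels [T2]) \<longrightarrow>
         (\<forall>a \<in> labels F \<union> labels [T2]. code a + 1 < W) \<longrightarrow>
         (fsize F + fsize [T2] + 1) ^ c \<le> W \<longrightarrow>
         (\<exists>s'. exec W (\<kappa> (fsize F + fsize [T2])) \<rho> P (input_state code F [T2]) s' \<and>
               mats s' 0 = sim_matrix F T2 \<and>
               time s' \<le> (max 1 (fsize F))\<^sup>2 * fsize [T2] * \<phi> (fsize F + fsize [T2]))))"
proof (intro exI[of _ sim_program] exI[of _ 4] allI impI)
  fix \<kappa> assume \<kappa>: "subpolynomial \<kappa>"
  \<comment> \<open>300 is the constant of \<open>sim_program_spec\<close>, and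
    \<open>20 + \<kappa> k\<close> is \<open>U\<close> for the charge
    \<open>\<kappa> k\<close>.\<close>
  define \<phi> where "\<phi> k = 300 * (20 + \<kappa> k)" for k
  have "subpolynomial \<phi>"
    unfolding subpolynomial_def
  proof (intro allI impI)
    fix \<epsilon> :: real assume "0 < \<epsilon>"
    then have "(\<lambda>n. real (\<kappa> n)) \<in> O(\<lambda>n. real n powr \<epsilon>)"
      using \<kappa> by (simp add: subpolynomial_def)
    moreover have "(\<lambda>n. 20 :: real) \<in> O(\<lambda>n :: nat. real n powr \<epsilon>)"
    proof (rule bigoI[where c = 20])
      show "\<forall>\<^sub>F n :: nat in sequentially. norm (20 :: real) \<le> 20 * norm (real n powr \<epsilon>)"
        using eventually_ge_at_top[of "1 :: nat"]
        by eventually_elim (use \<open>0 < \<epsilon>\<close> in \<open>simp add: ge_one_powr_ge_zero\<close>)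
    qed
    ultimately have "(\<lambda>n. 300 * (20 + real (\<kappa> n))) \<in> O(\<lambda>n. real n powr \<epsilon>)"
      by (intro landau_o.big.cmult_in_iff[THEN iffD2] sum_in_bigo) auto
    then show "(\<lambda>n. real (\<phi> n)) \<in> O(\<lambda>n. real n powr \<epsilon>)" by (simp add: \<phi>_def)
  qed
  moreover have "\<exists>s'. exec W (\<kappa> (fsize F + fsize [T])) \<rho> sim_program (input_state code F [T]) s' \<and>
      mats s' 0 = sim_matrix F T \<and>
      time s' \<le> (max 1 (fsize F))\<^sup>2 * fsize [T] * \<phi> (fsize F + fsize [T])"
    if inj: "inj_on code (labels F \<union> labels [T])" and W: "(fsize F + fsize [T] + 1) ^ 4 \<le> W"
    for F :: "'a forest" and T :: "'a rtree" and code W \<rho>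
  proof -
    define k where "k = fsize F + fsize [T] + 1"
    \<comment> \<open>\<open>T\<close> has at least one node, so \<open>k ^ 3\<close> is at least 8.
      Thus the exponent 4 yields the linear bound \<open>word_size\<close>.\<close>
    have "2 \<le> k" unfolding k_def by (cases T) simp
    then have "2 ^ 3 \<le> k ^ 3" by (rule power_mono) simp
    then have "8 * k \<le> k ^ 3 * k" by simp
    also have "\<dots> = k ^ 4" by (simp add: eval_nat_numeral)
    finally have "8 * k \<le> W" using W by (simp add: k_def)
    then interpret sim_machine W "\<kappa> (fsize F + fsize [T])" \<rho> T code "fsize F" "labels F \<union> labels [T]"
      using inj by unfold_locales (auto simp: k_def)
    from sim_program_spec[of F] show ?thesis
      by (simp add: wp_def m_def U_def \<phi>_def algebra_simps)
  qed
  ultimately show "\<exists>\<phi>. subpolynomial \<phi> \<and>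
      (\<forall>(F :: 'a forest) (T2 :: 'a rtree) (code :: 'a \<Rightarrow> nat) (W :: nat) (\<rho> :: nat \<Rightarrow> nat).
         inj_on code (labels F \<union> labels [T2]) \<longrightarrow>
         (\<forall>a \<in> labels F \<union> labels [T2]. code a + 1 < W) \<longrightarrow>
         (fsize F + fsize [T2] + 1) ^ 4 \<le> W \<longrightarrow>
         (\<exists>s'. exec W (\<kappa> (fsize F + fsize [T2])) \<rho> sim_program (input_state code F [T2]) s' \<and>
               mats s' 0 = sim_matrix F T2 \<and>
               time s' \<le> (max 1 (fsize F))\<^sup>2 * fsize [T2] * \<phi> (fsize F + fsize [T2])))"
    by blast
qed

end
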